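(* Let $\xi=(\xi_t)_{t\ge0}$ be a real-valued, time inhomogeneous Markov process with continuous paths whose semigroup $(P_{s,t})_{0\le s<t<\infty}$ has measurable densities, $P_{s,t}(x,dy)=p_{s,t}(x,y)\,dy$, and is $T$-periodic: $p_{s,t}(x,y)=p_{kT+s,kT+t}(x,y)$ for all $k\in\mathbb N_0$ and $0\le s<t<\infty$. Assume that the embedded chain $(\xi_{kT})_{k\in\mathbb N_0}$ is positive recurrent in the sense of Harris, with invariant probability $\mu$ on $(\mathbb R,\mathcal B(\mathbb R))$. a) Then the chain $X=(X_k)_{k\in\mathbb N_0}$ of $T$-segments in the path of $\xi$ is positive recurrent in the sense of Harris. Its invariant probability is the unique law $m$ on $(C_T,\mathcal C_T)$ such that for arbitrary $0=t_0<t_1<\dots<t_\ell<t_{\ell+1}=T$ and $A_i\in\mathcal B(\mathbb R)$, $$m\left(\{\pi_{t_i}\in A_i,\ 0\le i\le\ell+1\}\right)=\int\!\cdots\!\int\mu(dx_0)\,1_{A_0}(x_0)\prod_{i=0}^{\ell}P_{t_i,t_{i+1}}(x_i,dx_{i+1})\,1_{A_{i+1}}(x_{i+1}).$$ b) Let $A=(A_t)_{t\ge0}$ be an $\mathbb F^\xi$-increasing process for which there is a nonnegative $\mathcal C_T$-measurable function $F:C_T\to\mathbb R$ with $m(F):=\int_{C_T}F\,dm<\infty$ such that $$A_{kT}=\sum_{j=1}^kF(X_j)=\sum_{j=1}^kF\left((\xi_{(j-1)T+s})_{0\le s\le T}\right),\quad k\ge1 .$$ Then $$\lim_{t\to\infty}\frac1t\,A_t=\frac1T\,m(F)\quad\text{almost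 surely}.$$
   Context: $T>0$ is fixed. $\xi$ is defined on a canonical path space $(\Omega,\mathcal A,\mathbb F,(P_x)_{x\in\mathbb R})$, where under $P_x$ the process starts at $\xi_0=x$; $\mathbb F^\xi$ is the filtration generated by $\xi$. "Almost surely" means $P_x$-almost surely for every $x\in\mathbb R$. An $\mathbb F^\xi$-increasing process is an $\mathbb F^\xi$-adapted càdlàg process $A=(A_t)_{t\ge0}$ with nondecreasing paths and $A_0=0$, almost surely. $(C_T,\mathcal C_T)$ is the space of continuous functions $\alpha:[0,T]\to\mathbb R$ with the uniform metric and its Borel $\sigma$-field; $\pi_t$, $0\le t\le T$, are the coordinate projections. The chain of $T$-segments is the $(C_T,\mathcal C_T)$-valued chain $X_k:=(\xi_{(k-1)T+s})_{0\le s\le T}$, $k\ge1$, $X_0=\alpha_0\in C_T$; by $T$-periodicity it is a time homogeneous Markov chain with one-step transition kernel $Q(\alpha,F)=P\left((\xi_s)_{0\le s\le T}\in F\mid\xi_0=\alpha(T)\right)$, $\alpha\in C_T$, $F\in\mathcal C_T$. A chain is positive recurrent in the sense of Harris (positive Harris recurrent) if it has an invariant probability $\mu$ such that every measurable set $A$ with $\mu(A)>0$ is visited infinitely often almost surely, from every starting point. *)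

theory Defs
  imports "HOL-Probability.Probability"
begin

definition generated_algebra :: "'w set \<Rightarrow> 's measure \<Rightarrow> 'i set \<Rightarrow> ('i \<Rightarrow> 'w \<Rightarrow> 's) \<Rightarrow> 'w measure" where
  "generated_algebra \<Omega> S I Z = sigma \<Omega> (\<Union>i\<in>I. {Z i -` B \<inter> \<Omega> | B. B \<in> sets S})"

abbreviation natural_filtration :: "'w measure \<Rightarrow> (real \<Rightarrow> 'w \<Rightarrow> real) \<Rightarrow> real \<Rightarrow> 'w measure" where
  "natural_filtration \<A> \<xi> t \<equiv> generated_algebra (space \<A>) borel {0..t} \<xi>"

definition trans_kernel :: "(real \<Rightarrow> real \<Rightarrow> real \<Rightarrow> real \<Rightarrow> real) \<Rightarrow> real \<Rightarrow> real \<Rightarrow> real \<Rightarrow> real measure" where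
  "trans_kernel p s t x = density lborel (\<lambda>y. ennreal (p s t x y))"

definition transition_densities :: "(real \<Rightarrow> real \<Rightarrow> real \<Rightarrow> real \<Rightarrow> real) \<Rightarrow> bool" where
  "transition_densities p \<longleftrightarrow>
     (\<forall>s t. 0 \<le> s \<longrightarrow> s < t \<longrightarrow>
        (\<lambda>(x, y). p s t x y) \<in> borel_measurable (borel \<Otimes>\<^sub>M borel) \<and>
        (\<forall>x y. 0 \<le> p s t x y) \<and>
        (\<forall>x. prob_space (trans_kernel p s t x))) \<and>
     (\<forall>s t u x. 0 \<le> s \<longrightarrow> s < t \<longrightarrow> t < u \<longrightarrow>
        trans_kernel p s u x = trans_kernel p s t x \<bind> trans_kernel p t u)"

definition periodic_densities :: "real \<Rightarrow> (real \<Rightarrow> real \<Rightarrow> real \<Rightarrow> real \<Rightarrow> real) \<Rightarrow> bool" where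
  "periodic_densities T p \<longleftrightarrow>
     (\<forall>(k::nat) s t x y. 0 \<le> s \<longrightarrow> s < t \<longrightarrow>
        p s t x y = p (real k * T + s) (real k * T + t) x y)"

text \<open>
  The measurable space \<open>\<A>\<close> carries the process; \<open>P x\<close> is the law under which
  the process starts at \<open>x\<close>. Taking for \<open>\<A>\<close> the space of continuous paths and
  for \<open>\<xi>\<close> the coordinates gives the canonical setting.
  Only the restriction of \<open>\<xi>\<close> to times \<open>t \<ge> 0\<close> is relevant.
\<close>

definition continuous_markov_process ::
  "'w measure \<Rightarrow> (real \<Rightarrow> 'w measure) \<Rightarrow> (real \<Rightarrow> 'w \<Rightarrow> real) \<Rightarrow>
   (real \<Rightarrow> real \<Rightarrow> real \<Rightarrow> real \<Rightarrow> real) \<Rightarrow> bool" where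
  "continuous_markov_process \<A> P \<xi> p \<longleftrightarrow>
     transition_densities p \<and>
     (\<forall>t\<ge>0. \<xi> t \<in> borel_measurable \<A>) \<and>
     (\<forall>\<omega>\<in>space \<A>. continuous_on {0..} (\<lambda>t. \<xi> t \<omega>)) \<and>
     (\<forall>x. prob_space (P x) \<and> sets (P x) = sets \<A> \<and> (AE \<omega> in P x. \<xi> 0 \<omega> = x)) \<and>
     (\<forall>x s t. \<forall>B\<in>sets borel. 0 \<le> s \<longrightarrow> s < t \<longrightarrow>
        (AE \<omega> in P x.
           real_cond_exp (P x) (natural_filtration \<A> \<xi> s) (\<lambda>\<omega>. indicator B (\<xi> t \<omega>)) \<omega>
           = measure (trans_kernel p s t (\<xi> s \<omega>)) B))"

definition increasing_process ::
  "'w measure \<Rightarrow> (real \<Rightarrow> 'w measure) \<Rightarrow> (real \<Rightarrow> 'w \<Rightarrow> real) \<Rightarrow> (real \<Rightarrow> 'w \<Rightarrow> real) \<Rightarrow> bool" where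
  "increasing_process \<A> P \<xi> A \<longleftrightarrow>
     (\<forall>t\<ge>0. A t \<in> borel_measurable (natural_filtration \<A> \<xi> t)) \<and>
     (\<forall>x. AE \<omega> in P x.
        (\<forall>t\<ge>0. continuous (at_right t) (\<lambda>u. A u \<omega>)) \<and>
        (\<forall>t>0. \<exists>l. ((\<lambda>u. A u \<omega>) \<longlongrightarrow> l) (at_left t)) \<and>
        mono_on {0..} (\<lambda>t. A t \<omega>) \<and>
        A 0 \<omega> = 0)"

text \<open>
  For each starting point \<open>x\<close> the chain is a sequence \<open>Z x\<close> of random variables
  under the probability measure \<open>P x\<close>. The random variables themselves may depend
  on \<open>x\<close>, because the chain of segments has a prescribed, non-random \<open>X\<^sub>0\<close>.
\<close>

definition markov_chain ::
  "'s measure \<Rightarrow> ('s \<Rightarrow> 's measure) \<Rightarrow> ('s \<Rightarrow> 'w measure) \<Rightarrow> ('s \<Rightarrow> nat \<Rightarrow> 'w \<Rightarrow> 's) \<Rightarrow> bool" where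
  "markov_chain S K P Z \<longleftrightarrow>
     K \<in> S \<rightarrow>\<^sub>M prob_algebra S \<and>
     (\<forall>x\<in>space S.
        prob_space (P x) \<and>
        (\<forall>k. Z x k \<in> P x \<rightarrow>\<^sub>M S) \<and>
        (AE \<omega> in P x. Z x 0 \<omega> = x) \<and>
        (\<forall>k. \<forall>B\<in>sets S. AE \<omega> in P x.
           real_cond_exp (P x) (generated_algebra (space (P x)) S {..k} (Z x))
             (\<lambda>\<omega>. indicator B (Z x (Suc k) \<omega>)) \<omega>
           = measure (K (Z x k \<omega>)) B))"

definition invariant_probability :: "'s measure \<Rightarrow> ('s \<Rightarrow> 's measure) \<Rightarrow> 's measure \<Rightarrow> bool" where
  "invariant_probability S K \<mu> \<longleftrightarrow> prob_space \<mu> \<and> sets \<mu> = sets S \<and> \<mu> \<bind> K = \<mu>"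

definition positive_harris ::
  "'s measure \<Rightarrow> ('s \<Rightarrow> 's measure) \<Rightarrow> ('s \<Rightarrow> 'w measure) \<Rightarrow> ('s \<Rightarrow> nat \<Rightarrow> 'w \<Rightarrow> 's) \<Rightarrow>
   's measure \<Rightarrow> bool" where
  "positive_harris S K P Z \<mu> \<longleftrightarrow>
     markov_chain S K P Z \<and>
     invariant_probability S K \<mu> \<and>
     (\<forall>B\<in>sets S. emeasure \<mu> B > 0 \<longrightarrow>
        (\<forall>x\<in>space S. AE \<omega> in P x. \<exists>\<^sub>\<infinity>k. Z x k \<omega> \<in> B))"

definition C_metric :: "real \<Rightarrow> (real \<Rightarrow> real) metric" where
  "C_metric T = cfunspace (top_of_set {0..T}) euclidean_metric"

definition C_space :: "real \<Rightarrow> (real \<Rightarrow> real) measure" where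
  "C_space T = sigma (mspace (C_metric T)) {U. openin (mtopology_of (C_metric T)) U}"

text \<open>The elements of \<open>C_space T\<close> are continuous functions on \<open>{0..T}\<close>, set to
  \<open>undefined\<close> outside this interval.\<close>

lemma space_C_space:
  "space (C_space T) = {\<alpha>. continuous_on {0..T} \<alpha> \<and> \<alpha> \<in> extensional {0..T}}"
proof -
  have bd: "bounded (\<alpha> ` {0..T})" if "continuous_on {0..T} \<alpha>" for \<alpha> :: "real \<Rightarrow> real"
    using that by (intro compact_imp_bounded compact_continuous_image) auto
  have "mspace (C_metric T) = {\<alpha>. continuous_on {0..T} \<alpha> \<and> \<alpha> \<in> extensional {0..T}}"
    using bd by (auto simp: C_metric_def Met_TC.fspace_def)
  moreover have "{U. openin (mtopology_of (C_metric T)) U} \<subseteq> Pow (mspace (C_metric T))"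
    using openin_subset[of "mtopology_of (C_metric T)"] by auto
  ultimately show ?thesis
    by (simp add: C_space_def space_measure_of)
qed

definition segment :: "real \<Rightarrow> (real \<Rightarrow> 'w \<Rightarrow> real) \<Rightarrow> nat \<Rightarrow> 'w \<Rightarrow> real \<Rightarrow> real" where
  "segment T \<xi> k \<omega> = (\<lambda>s\<in>{0..T}. \<xi> ((real k - 1) * T + s) \<omega>)"

definition segment_chain ::
  "real \<Rightarrow> (real \<Rightarrow> 'w \<Rightarrow> real) \<Rightarrow> (real \<Rightarrow> real) \<Rightarrow> nat \<Rightarrow> 'w \<Rightarrow> real \<Rightarrow> real" where
  "segment_chain T \<xi> \<alpha>\<^sub>0 k \<omega> = (if k = 0 then \<alpha>\<^sub>0 else segment T \<xi> k \<omega>)"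

definition segment_kernel ::
  "real \<Rightarrow> (real \<Rightarrow> 'w measure) \<Rightarrow> (real \<Rightarrow> 'w \<Rightarrow> real) \<Rightarrow> (real \<Rightarrow> real) \<Rightarrow> (real \<Rightarrow> real) measure" where
  "segment_kernel T P \<xi> \<alpha> = distr (P (\<alpha> T)) (C_space T) (segment T \<xi> 1)"

text \<open>
  \<open>cylinder_integral p t B i n x\<close> is the iterated integral
  \<open>1\<^bsub>B i\<^esub>(x\<^sub>i) \<integral>\<dots>\<integral> \<Prod>j=i..<i+n. P\<^bsub>t j,t (j+1)\<^esub>(x\<^sub>j,dx\<^bsub>j+1\<^esub>) 1\<^bsub>B (j+1)\<^esub>(x\<^bsub>j+1\<^esub>)\<close>
  at \<open>x\<^sub>i = x\<close>.
\<close>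

primrec cylinder_integral ::
  "(real \<Rightarrow> real \<Rightarrow> real \<Rightarrow> real \<Rightarrow> real) \<Rightarrow> (nat \<Rightarrow> real) \<Rightarrow> (nat \<Rightarrow> real set) \<Rightarrow>
   nat \<Rightarrow> nat \<Rightarrow> real \<Rightarrow> ennreal" where
  "cylinder_integral p t B i 0 x = indicator (B i) x"
| "cylinder_integral p t B i (Suc n) x =
     indicator (B i) x *
     (\<integral>\<^sup>+ y. cylinder_integral p t B (Suc i) n y \<partial>trans_kernel p (t i) (t (Suc i)) x)"

definition segment_law ::
  "real \<Rightarrow> (real \<Rightarrow> real \<Rightarrow> real \<Rightarrow> real \<Rightarrow> real) \<Rightarrow> real measure \<Rightarrow> (real \<Rightarrow> real) measure \<Rightarrow> bool" where
  "segment_law T p \<mu> m \<longleftrightarrow>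
     prob_space m \<and> sets m = sets (C_space T) \<and>
     (\<forall>(l::nat) t B. t 0 = 0 \<longrightarrow> t (l + 1) = T \<longrightarrow> (\<forall>i\<le>l. t i < t (i + 1)) \<longrightarrow>
        (\<forall>i\<le>l + 1. B i \<in> sets borel) \<longrightarrow>
        emeasure m {\<alpha> \<in> space m. \<forall>i\<le>l + 1. \<alpha> (t i) \<in> B i}
        = (\<integral>\<^sup>+ x. cylinder_integral p t B 0 (l + 1) x \<partial>\<mu>))"

end

theory Submission
  imports Defs
begin

text \<open>
  Everything reduces to a law of large numbers for the segments that holds from every
  starting point. Each shift-invariant event has a probability \<open>h x\<close> which is a bounded
  harmonic function of the starting point, and Harris recurrence forces \<open>h\<close> to be constant.
  Hence under the stationary path law an invariant event is independent of the first segment,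
  and the maximal ergodic inequality, applied on the event that the sums of \<open>F - b\<close> are
  unbounded above, shows that this event is null for every starting point as soon as
  \<open>b > m(F)\<close>; the same with \<open>-F\<close> gives convergence of the averages. Taking indicator functions for \<open>F\<close>
  yields both the recurrence of the segment chain and the uniqueness of its invariant
  probability. Monotonicity of \<open>A\<close> passes from multiples of \<open>T\<close> to all times.
\<close>

text \<open>The difficulty is the quantifier over starting points. An ergodic theorem for the
  stationary law holds outside a null set of initial values, whereas recurrence and the limit are
  claimed from every initial value. So null sets are not transferred from the stationary law; what
  is transferred is the constant value of the probability of an invariant event. This requires
  events that are invariant pointwise, not merely up to null sets. The segment kernel sees a segment
  only through its endpoint. The harmonic functions therefore live on the real line, where the
  Harris property is given, and the segment chain started in \<alpha> is studied under
  \<open>P (\<alpha> T)\<close>. Independence of the first segment is enough, because the maximal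
  inequality only involves the integral of \<open>F - b\<close>, evaluated at the first segment,
  over the event.\<close>

section \<open>The maximal ergodic inequality\<close>

text \<open>The maximum of the partial sums \<open>g + g \<circ> \<theta> + \<dots>\<close> of length at most \<open>n\<close>, written so that
  Garsia's proof of the maximal ergodic inequality reads off from the recursion.\<close>

primrec max_sum :: "('a \<Rightarrow> 'a) \<Rightarrow> ('a \<Rightarrow> real) \<Rightarrow> nat \<Rightarrow> 'a \<Rightarrow> real" where
  "max_sum \<theta> g 0 w = 0"
| "max_sum \<theta> g (Suc n) w = max 0 (g w + max_sum \<theta> g n (\<theta> w))"

lemma max_sum_nonneg: "0 \<le> max_sum \<theta> g n w"
  by (cases n) auto

lemma max_sum_Suc_mono: "max_sum \<theta> g n w \<le> max_sum \<theta> g (Suc n) w"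
proof (induction n arbitrary: w)
  case (Suc n)
  then show ?case
    using add_left_mono[OF Suc[of "\<theta> w"], of "g w"] by (simp only: max_sum.simps(2))
qed simp

text \<open>Links the recursion to ordinary partial sums: one positive partial sum of length at most
  \<open>n\<close> already makes \<open>max_sum \<theta> g n w\<close> positive.\<close>

lemma sum_le_max_sum: "k \<le> n \<Longrightarrow> (\<Sum>j<k. g ((\<theta> ^^ j) w)) \<le> max_sum \<theta> g n w"
proof (induction n arbitrary: k w)
  case (Suc n)
  show ?case
  proof (cases k)
    case 0
    then show ?thesis by (simp add: max_sum_nonneg del: max_sum.simps)
  next
    case (Suc i)
    then have "(\<Sum>j<i. g ((\<theta> ^^ j) (\<theta> w))) \<le> max_sum \<theta> g n (\<theta> w)"
      using Suc.IH Suc.prems by auto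
    with Suc show ?thesis
      by (simp add: sum.lessThan_Suc_shift funpow_swap1 del: sum.lessThan_Suc)
  qed
qed simp

lemma integrable_compose_invariant:
  fixes g :: "'a \<Rightarrow> real"
  assumes "\<theta> \<in> P \<rightarrow>\<^sub>M P" and "distr P P \<theta> = P" and "integrable P g"
  shows "integrable P (\<lambda>w. g (\<theta> w))" and "(\<integral>w. g (\<theta> w) \<partial>P) = (\<integral>w. g w \<partial>P)"
proof -
  show "integrable P (\<lambda>w. g (\<theta> w))"
    using integrable_distr[OF assms(1), of g] assms(2,3) by simp
  show "(\<integral>w. g (\<theta> w) \<partial>P) = (\<integral>w. g w \<partial>P)"
    using integral_distr[OF assms(1), of g] assms(2,3) by simp
qed

lemma integrable_max_sum:
  assumes "\<theta> \<in> P \<rightarrow>\<^sub>M P" and "distr P P \<theta> = P" and "integrable P g"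
  shows "integrable P (max_sum \<theta> g n)"
proof (induction n)
  case 0
  then show ?case by simp
next
  case (Suc n)
  then have "integrable P (\<lambda>w. max 0 (g w + max_sum \<theta> g n (\<theta> w)))"
    using integrable_compose_invariant(1)[OF assms(1,2) Suc] assms(3)
    by (intro integrable_max) auto
  then show ?case by simp
qed

text \<open>Garsia's argument, with \<open>M\<close> the maximum over lengths up to
  \<open>Suc n\<close>. Where \<open>M > 0\<close>, the recursion gives
  \<open>M = g + max_sum \<theta> g n \<circ> \<theta>\<close>, which is at most
  \<open>g + M \<circ> \<theta>\<close>; elsewhere \<open>M = 0\<close> and
  \<open>M \<circ> \<theta>\<close> is nonnegative. Hence \<open>M - M \<circ> \<theta>\<close> is
  at most \<open>g\<close> on \<open>{M > 0}\<close> and at most 0 off it, and its integral vanishes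
  by invariance of \<open>P\<close>.\<close>

lemma maximal_ergodic:
  assumes "\<theta> \<in> P \<rightarrow>\<^sub>M P" and "distr P P \<theta> = P" and "integrable P g"
  shows "0 \<le> (\<integral>w. g w * indicator {w. 0 < max_sum \<theta> g (Suc n) w} w \<partial>P)"
proof -
  let ?M = "max_sum \<theta> g (Suc n)"
  note M = integrable_max_sum[OF assms, of "Suc n"]
  note M\<theta> = integrable_compose_invariant[OF assms(1,2) M]
  have [measurable]: "?M \<in> borel_measurable P" "g \<in> borel_measurable P"
    using M assms(3) by auto
  have "{w\<in>space P. 0 < ?M w} \<in> sets P" by measurable
  then have "integrable P (\<lambda>w. g w * indicator {w\<in>space P. 0 < ?M w} w)"
    by (intro integrable_real_mult_indicator assms(3))
  then have gi: "integrable P (\<lambda>w. g w * indicator {w. 0 < ?M w} w)"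
    by (rule Bochner_Integration.integrable_cong[THEN iffD1, OF refl, rotated]) (auto simp: indicator_def)
  have "0 = (\<integral>w. ?M w - ?M (\<theta> w) \<partial>P)"
    by (simp only: Bochner_Integration.integral_diff[OF M M\<theta>(1)] M\<theta>(2) diff_self)
  also have "\<dots> \<le> (\<integral>w. g w * indicator {w. 0 < ?M w} w \<partial>P)"
  proof (rule integral_mono[OF Bochner_Integration.integrable_diff[OF M M\<theta>(1)] gi])
    fix w
    have "max_sum \<theta> g n (\<theta> w) \<le> ?M (\<theta> w)" "0 \<le> ?M (\<theta> w)"
      using max_sum_Suc_mono[of \<theta> g n] max_sum_nonneg by metis+
    then show "?M w - ?M (\<theta> w) \<le> g w * indicator {w. 0 < ?M w} w"
      by (auto simp: indicator_def max_def split: if_splits simp del: max_sum.simps(2))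
         (auto simp: max_def split: if_splits)
  qed
  finally show ?thesis .
qed

text \<open>The maximal inequality is applied to \<open>g = f * indicator E\<close>. As
  \<open>E\<close> is invariant, an orbit starting in \<open>E\<close> stays there, so along it the
  sums of \<open>g\<close> are those of \<open>f\<close>. The length of the positive sum varies with
  the point, so the inequality at horizon \<open>n\<close> only yields the claim in the
  limit.\<close>

lemma integral_nonneg_of_positive_sums:
  fixes f :: "'a \<Rightarrow> real"
  assumes \<theta>: "\<theta> \<in> P \<rightarrow>\<^sub>M P" and inv: "distr P P \<theta> = P" and f: "integrable P f"
    and E: "E \<in> sets P" and E_inv: "\<And>w. w \<in> space P \<Longrightarrow> \<theta> w \<in> E \<longleftrightarrow> w \<in> E"
    and pos: "\<And>w. w \<in> E \<Longrightarrow> \<exists>k. 0 < (\<Sum>j<k. f ((\<theta> ^^ j) w))"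
  shows "0 \<le> (\<integral>w. f w * indicator E w \<partial>P)"
proof -
  define g where "g w = f w * indicator E w" for w
  have g: "integrable P g"
    unfolding g_def using integrable_real_mult_indicator[OF E f] .
  define A where "A n = {w. 0 < max_sum \<theta> g (Suc n) w}" for n
  have \<theta>n: "(\<theta> ^^ j) w \<in> space P" if "w \<in> space P" for j w
    using that measurable_space[OF \<theta>] by (induction j) auto
  have E_invn: "(\<theta> ^^ j) w \<in> E \<longleftrightarrow> w \<in> E" if "w \<in> space P" for j w
    using \<theta>n[OF that] E_inv by (induction j) auto
  \<comment> \<open>Outside \<open>E\<close> both sides are zero because \<open>g\<close> vanishes
    there, so it does not matter whether \<open>A n\<close> contains points outside
    \<open>E\<close>.\<close>
  have lim: "(\<lambda>n. g w * indicator (A n) w) \<longlonglongrightarrow> g w" if w: "w \<in> space P" for w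
  proof (cases "w \<in> E")
    case True
    then obtain k where "0 < (\<Sum>j<k. f ((\<theta> ^^ j) w))" using pos by blast
    also have "(\<Sum>j<k. f ((\<theta> ^^ j) w)) = (\<Sum>j<k. g ((\<theta> ^^ j) w))"
      using True E_invn[OF w] by (simp add: g_def)
    finally have k: "0 < (\<Sum>j<k. g ((\<theta> ^^ j) w))" .
    have "w \<in> A n" if "k \<le> n" for n
      using k sum_le_max_sum[of k "Suc n" g \<theta> w] that unfolding A_def
      by (auto simp del: max_sum.simps)
    then have "\<forall>\<^sub>F n in sequentially. g w * indicator (A n) w = g w"
      by (auto simp: eventually_sequentially intro!: exI[of _ k])
    then show ?thesis by (rule tendsto_eventually)
  next
    case False
    then show ?thesis by (simp add: g_def)
  qed
  have [measurable]: "A n \<inter> space P \<in> sets P" for n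
  proof -
    have [measurable]: "max_sum \<theta> g (Suc n) \<in> borel_measurable P"
      using integrable_max_sum[OF \<theta> inv g] by blast
    have "A n \<inter> space P = {w\<in>space P. 0 < max_sum \<theta> g (Suc n) w}" by (auto simp: A_def)
    then show ?thesis by (simp del: max_sum.simps)
  qed
  have "(\<lambda>n. \<integral>w. g w * indicator (A n) w \<partial>P) \<longlonglongrightarrow> (\<integral>w. g w \<partial>P)"
  proof (rule integral_dominated_convergence[where w="\<lambda>w. \<bar>g w\<bar>"])
    show "(\<lambda>w. g w * indicator (A n) w) \<in> borel_measurable P" for n
    proof -
      have "(\<lambda>w. g w * indicator (A n \<inter> space P) w) \<in> borel_measurable P"
        using g by measurable
      then show ?thesis by (rule measurable_cong[THEN iffD1, rotated]) (auto simp: indicator_def)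
    qed
  qed (use g lim in \<open>auto simp: indicator_def\<close>)
  then show ?thesis
    using maximal_ergodic[OF \<theta> inv g] unfolding A_def g_def[symmetric]
    by (intro LIMSEQ_le_const) auto
qed

section \<open>Harris recurrent chains on a path space\<close>

text \<open>Here \<open>w\<close> is a whole path, \<open>X w\<close> its first segment,
  \<open>z w\<close> its initial state and \<theta> the shift by one period. The assumption
  \<open>markov\<close> treats the first segment and the shifted path jointly. No transition kernel
  on \<open>S\<close> is named: invariance speaks of the state of the shifted path, and recurrence
  is reduced to one visit, since only hitting a set of positive measure is used.\<close>

locale harris_paths =
  fixes M :: "'w measure" and S :: "'s measure" and C :: "'c measure"
    and L :: "'s \<Rightarrow> 'w measure" and \<theta> :: "'w \<Rightarrow> 'w"
    and X :: "'w \<Rightarrow> 'c" and z :: "'w \<Rightarrow> 's" and \<mu> :: "'s measure"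
  assumes L[measurable]: "L \<in> S \<rightarrow>\<^sub>M prob_algebra M"
    and \<theta>[measurable]: "\<theta> \<in> M \<rightarrow>\<^sub>M M"
    and X[measurable]: "X \<in> M \<rightarrow>\<^sub>M C"
    and z[measurable]: "z \<in> M \<rightarrow>\<^sub>M S"
    and start: "x \<in> space S \<Longrightarrow> AE w in L x. z w = x"
    and markov: "x \<in> space S \<Longrightarrow> G \<in> sets C \<Longrightarrow> H \<in> sets M \<Longrightarrow>
      emeasure (L x) {w \<in> space M. X w \<in> G \<and> \<theta> w \<in> H}
      = (\<integral>\<^sup>+w. emeasure (L (z (\<theta> w))) H * indicator {w \<in> space M. X w \<in> G} w \<partial>L x)"
    and prob_space_\<mu>: "prob_space \<mu>" and sets_\<mu>[measurable_cong, simp]: "sets \<mu> = sets S"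
    and invariant_\<mu>: "distr (\<mu> \<bind> L) S (\<lambda>w. z (\<theta> w)) = \<mu>"
    and recurrent: "B \<in> sets S \<Longrightarrow> 0 < emeasure \<mu> B \<Longrightarrow> x \<in> space S \<Longrightarrow>
      AE w in L x. \<exists>k. z ((\<theta> ^^ k) w) \<in> B"
begin

lemma space_\<mu>[simp]: "space \<mu> = space S"
  by (rule sets_eq_imp_space_eq) simp

lemma space_S_nonempty: "space S \<noteq> {}"
  using prob_space.not_empty[OF prob_space_\<mu>] by simp

lemma prob_space_L: "x \<in> space S \<Longrightarrow> prob_space (L x)"
  and sets_L: "x \<in> space S \<Longrightarrow> sets (L x) = sets M"
  using measurable_space[OF L] by (auto simp: space_prob_algebra)

lemma space_L: "x \<in> space S \<Longrightarrow> space (L x) = space M"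
  by (rule sets_eq_imp_space_eq) (rule sets_L)

lemma L_subprob[measurable]: "L \<in> S \<rightarrow>\<^sub>M subprob_algebra M"
  using L by (rule measurable_prob_algebraD)

lemma shift_emeasure:
  assumes x: "x \<in> space S" and H: "H \<in> sets M"
  shows "emeasure (L x) {w \<in> space M. \<theta> w \<in> H} = (\<integral>\<^sup>+w. emeasure (L (z (\<theta> w))) H \<partial>L x)"
proof -
  have "emeasure (L x) {w \<in> space M. \<theta> w \<in> H} = emeasure (L x) {w \<in> space M. X w \<in> space C \<and> \<theta> w \<in> H}"
    using measurable_space[OF X] by (intro arg_cong[where f="emeasure (L x)"]) auto
  also have "\<dots> = (\<integral>\<^sup>+w. emeasure (L (z (\<theta> w))) H * indicator {w \<in> space M. X w \<in> space C} w \<partial>L x)"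
    by (rule markov[OF x sets.top H])
  also have "\<dots> = (\<integral>\<^sup>+w. emeasure (L (z (\<theta> w))) H \<partial>L x)"
    using measurable_space[OF X] x by (intro nn_integral_cong) (auto simp: space_L)
  finally show ?thesis .
qed

lemma funpow_measurable[measurable]: "\<theta> ^^ k \<in> M \<rightarrow>\<^sub>M M"
  by (induction k) (auto intro: measurable_comp[OF _ \<theta>])

text \<open>\<open>h x = L x H\<close> is harmonic. Stopping the chain at its first visit to \<open>{h > c}\<close>, which happens
  almost surely by recurrence, gives \<open>h \<ge> c\<close> everywhere.\<close>

lemma invariant_event_ge:
  assumes H: "H \<in> sets M" and H_inv: "\<And>w. w \<in> space M \<Longrightarrow> \<theta> w \<in> H \<longleftrightarrow> w \<in> H"
    and pos: "0 < emeasure \<mu> {x \<in> space S. c < emeasure (L x) H}" and x: "x \<in> space S"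
  shows "c \<le> emeasure (L x) H"
proof -
  define B where "B = {x \<in> space S. c < emeasure (L x) H}"
  have h[measurable]: "(\<lambda>x. emeasure (L x) H) \<in> borel_measurable S"
    using H by measurable
  have B[measurable]: "B \<in> sets S" unfolding B_def by measurable
  have Hset: "{w \<in> space M. \<theta> w \<in> H} = H"
    using H_inv sets.sets_into_space[OF H] by blast
  define hit where "hit n = {w \<in> space M. \<exists>k\<le>n. z ((\<theta> ^^ k) w) \<in> B}" for n
  have hit[measurable]: "hit n \<in> sets M" for n unfolding hit_def by measurable
  \<comment> \<open>Induction on the horizon stands in for the strong Markov property at the hitting
    time. For \<open>x\<close> in \<open>B\<close> the value at \<open>x\<close> exceeds
    \<open>c\<close>. Otherwise time 0 is almost surely not a visit, so a visit by time
    \<open>Suc n\<close> is a visit by time \<open>n\<close> after the shift; the induction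
    hypothesis is averaged over the next state, and harmonicity returns the value at
    \<open>x\<close>.\<close>
  have *: "c * emeasure (L x) (hit n) \<le> emeasure (L x) H" if x: "x \<in> space S" for n x
    using x
  proof (induction n arbitrary: x)
    case (0 x)
    interpret prob_space "L x" by (rule prob_space_L[OF 0])
    show ?case
    proof (cases "x \<in> B")
      case True
      have "c * emeasure (L x) (hit 0) \<le> c * 1"
        using emeasure_le_1 by (intro mult_left_mono) auto
      with True show ?thesis by (auto simp: B_def)
    next
      case False
      then have "AE w in L x. w \<notin> hit 0" using start[OF 0] by (auto simp: hit_def)
      then have "emeasure (L x) (hit 0) = 0"
        using AE_iff_null_sets[of "hit 0" "L x"] 0 hit by (simp add: sets_L null_sets_def)
      then show ?thesis by simp
    qed
  next
    case (Suc n x)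
    interpret prob_space "L x" by (rule prob_space_L[OF Suc.prems])
    show ?case
    proof (cases "x \<in> B")
      case True
      have "c * emeasure (L x) (hit (Suc n)) \<le> c * 1"
        using emeasure_le_1 by (intro mult_left_mono) auto
      with True show ?thesis by (auto simp: B_def)
    next
      case False
      have z\<theta>: "z (\<theta> w) \<in> space S" if "w \<in> space (L x)" for w
        using that Suc.prems measurable_space[OF \<theta>] measurable_space[OF z] by (simp add: space_L)
      have "AE w in L x. w \<in> hit (Suc n) \<longleftrightarrow> w \<in> {w \<in> space M. \<theta> w \<in> hit n}"
        using start[OF Suc.prems] AE_space
      proof eventually_elim
        case (elim w)
        then have w: "w \<in> space M" "\<theta> w \<in> space M" "z w \<notin> B"
          using False measurable_space[OF \<theta>] Suc.prems by (auto simp: space_L)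
        have "(\<exists>k\<le>Suc n. z ((\<theta> ^^ k) w) \<in> B) \<longleftrightarrow> (\<exists>k\<le>n. z ((\<theta> ^^ k) (\<theta> w)) \<in> B)"
          (is "?l = ?r")
        proof
          assume ?l
          then obtain k where k: "k \<le> Suc n" "z ((\<theta> ^^ k) w) \<in> B" by blast
          with w obtain i where "k = Suc i" by (cases k) auto
          with k show ?r by (auto simp: funpow_swap1)
        next
          assume ?r
          then obtain k where "k \<le> n" "z ((\<theta> ^^ k) (\<theta> w)) \<in> B" by blast
          then show ?l by (intro exI[of _ "Suc k"]) (auto simp: funpow_swap1)
        qed
        with w show ?case by (simp add: hit_def)
      qed
      then have "emeasure (L x) (hit (Suc n)) = emeasure (L x) {w \<in> space M. \<theta> w \<in> hit n}"
        using Suc.prems by (intro emeasure_eq_AE) (auto simp: sets_L)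
      also have "\<dots> = (\<integral>\<^sup>+w. emeasure (L (z (\<theta> w))) (hit n) \<partial>L x)"
        by (rule shift_emeasure[OF Suc.prems hit])
      finally have "c * emeasure (L x) (hit (Suc n)) = (\<integral>\<^sup>+w. c * emeasure (L (z (\<theta> w))) (hit n) \<partial>L x)"
        using Suc.prems by (subst nn_integral_cmult) (auto cong: measurable_cong_sets simp: sets_L)
      also have "\<dots> \<le> (\<integral>\<^sup>+w. emeasure (L (z (\<theta> w))) H \<partial>L x)"
        using Suc.IH z\<theta> by (intro nn_integral_mono) auto
      also have "\<dots> = emeasure (L x) H"
        using shift_emeasure[OF Suc.prems H] Hset by simp
      finally show ?thesis .
    qed
  qed
  interpret prob_space "L x" by (rule prob_space_L[OF x])
  have "(\<lambda>n. emeasure (L x) (hit n)) \<longlonglongrightarrow> emeasure (L x) (\<Union>n. hit n)"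
    using x by (intro Lim_emeasure_incseq) (auto simp: sets_L incseq_def hit_def intro: order_trans)
  also have "emeasure (L x) (\<Union>n. hit n) = 1"
  proof (rule emeasure_eq_1_AE)
    show "(\<Union>n. hit n) \<in> events" using x by (auto simp: sets_L)
    show "AE w in L x. w \<in> (\<Union>n. hit n)"
      using recurrent[OF B _ x] pos AE_space x
      unfolding B_def[symmetric] by (auto simp: hit_def space_L)
  qed
  finally have "(\<lambda>n. emeasure (L x) (hit n)) \<longlonglongrightarrow> 1" .
  \<comment> \<open>Something exceeds \<open>c\<close> on a set of positive measure, so
    \<open>c\<close> is finite, and the limit may be taken inside the product.\<close>
  moreover have "c < \<top>"
    using pos by (cases "c = \<top>") (auto simp: top.not_eq_extremum)
  ultimately have "(\<lambda>n. c * emeasure (L x) (hit n)) \<longlonglongrightarrow> c * 1"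
    by (intro ennreal_tendsto_cmult) auto
  then show ?thesis
    using *[OF x] by (intro LIMSEQ_le_const2[where a="emeasure (L x) H" and x=c]) auto
qed


text \<open>Used in both directions it makes \<open>h x = measure (L x) H\<close> constant. If
  \<open>h y < c < d < h x\<close>, then \<open>{h > c}\<close> must be \<mu>-null, since otherwise
  \<open>h y\<close> would be at least \<open>c\<close>. So the complement of \<open>H\<close> has
  probability at least \<open>1 - c\<close>, hence more than \<open>1 - d\<close>, from \<mu>-almost
  every point, and the lower bound for the complement forces \<open>h x\<close> to be at most
  \<open>d\<close>. Two levels are taken because the lower bound asks for strict exceedance.\<close>

lemma invariant_event_le:
  assumes H: "H \<in> sets M" and H_inv: "\<And>w. w \<in> space M \<Longrightarrow> \<theta> w \<in> H \<longleftrightarrow> w \<in> H"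
    and x: "x \<in> space S" and y: "y \<in> space S"
  shows "measure (L x) H \<le> measure (L y) H"
proof (rule ccontr)
  interpret \<mu>: prob_space \<mu> by (rule prob_space_\<mu>)
  assume "\<not> ?thesis"
  then obtain c d where cd: "measure (L y) H < c" "c < d" "d < measure (L x) H"
    using dense[of "measure (L y) H"] dense by (metis not_le)
  have c: "0 \<le> c" using cd(1) measure_nonneg[of "L y" H] by linarith
  have d: "d \<le> 1" using cd(3) prob_space.prob_le_1[OF prob_space_L[OF x], of H] by linarith
  have em: "emeasure (L u) H = ennreal (measure (L u) H)" if "u \<in> space S" for u
  proof -
    interpret prob_space "L u" by (rule prob_space_L[OF that])
    show ?thesis by (rule emeasure_eq_measure)
  qed
  let ?H' = "space M - H"
  have em': "emeasure (L u) ?H' = ennreal (1 - measure (L u) H)" if "u \<in> space S" for u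
  proof -
    interpret prob_space "L u" by (rule prob_space_L[OF that])
    show ?thesis using prob_compl[of H] H that
      by (simp add: emeasure_eq_measure sets_L space_L)
  qed
  have [measurable]: "(\<lambda>u. measure (L u) H) \<in> borel_measurable S"
    using H by measurable
  have "\<not> 0 < emeasure \<mu> {u \<in> space S. ennreal c < emeasure (L u) H}"
  proof
    assume "0 < emeasure \<mu> {u \<in> space S. ennreal c < emeasure (L u) H}"
    from invariant_event_ge[OF H H_inv this y] show False
      using cd(1) by (simp add: em y)
  qed
  then have "emeasure \<mu> {u \<in> space S. c < measure (L u) H} = 0"
    using c by (simp add: em ennreal_less_iff cong: conj_cong)
  moreover have "emeasure \<mu> {u \<in> space S. c < measure (L u) H} + emeasure \<mu> {u \<in> space S. measure (L u) H \<le> c}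
      = emeasure \<mu> (space \<mu>)"
    by (subst plus_emeasure) (auto intro!: arg_cong[where f="emeasure \<mu>"])
  ultimately have "emeasure \<mu> {u \<in> space S. measure (L u) H \<le> c} = 1"
    using \<mu>.emeasure_space_1 by simp
  moreover have "emeasure \<mu> {u \<in> space S. measure (L u) H \<le> c}
      \<le> emeasure \<mu> {u \<in> space S. ennreal (1 - d) < emeasure (L u) ?H'}"
    using cd(2) d by (intro emeasure_mono) (auto simp: em' ennreal_less_iff cong: conj_cong)
  ultimately have "0 < emeasure \<mu> {u \<in> space S. ennreal (1 - d) < emeasure (L u) ?H'}"
    by (metis less_le_trans zero_less_one)
  from invariant_event_ge[OF _ _ this x] have "ennreal (1 - d) \<le> emeasure (L x) ?H'"
    using H H_inv measurable_space[OF \<theta>] by auto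
  then show False
    using cd(3) prob_space.prob_le_1[OF prob_space_L[OF x], of H] by (simp add: em' x ennreal_le_iff)
qed

text \<open>Invariance of the initial law under one step becomes invariance of the path law, because
  the shifted path is again governed by \<open>L\<close> from its new initial state. It is stated
  for any \<nu> since the uniqueness proof applies it to an unknown invariant law.\<close>

lemma shift_invariant_bind:
  assumes \<nu>: "prob_space \<nu>" and [measurable_cong, simp]: "sets \<nu> = sets S"
    and inv: "distr (\<nu> \<bind> L) S (\<lambda>w. z (\<theta> w)) = \<nu>"
  shows "distr (\<nu> \<bind> L) M \<theta> = \<nu> \<bind> L"
proof (rule measure_eqI)
  interpret prob_space \<nu> by fact
  have sp[simp]: "space \<nu> = space S" by (rule sets_eq_imp_space_eq) simp
  have ne: "space \<nu> \<noteq> {}" by (rule not_empty)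
  have [measurable]: "L \<in> \<nu> \<rightarrow>\<^sub>M subprob_algebra M" by measurable
  have sets_P[measurable_cong]: "sets (\<nu> \<bind> L) = sets M"
    by (rule sets_bind[OF _ ne]) (simp add: sets_L)
  have space_P: "space (\<nu> \<bind> L) = space M"
    by (rule sets_eq_imp_space_eq) fact
  show "sets (distr (\<nu> \<bind> L) M \<theta>) = sets (\<nu> \<bind> L)"
    by (simp add: sets_P)
  fix H assume "H \<in> sets (distr (\<nu> \<bind> L) M \<theta>)"
  then have H[measurable]: "H \<in> sets M" by simp
  have "emeasure (distr (\<nu> \<bind> L) M \<theta>) H = emeasure (\<nu> \<bind> L) {w \<in> space M. \<theta> w \<in> H}"
    by (subst emeasure_distr) (auto simp: space_P intro!: arg_cong[where f="emeasure (\<nu> \<bind> L)"])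
  also have "\<dots> = (\<integral>\<^sup>+x. emeasure (L x) {w \<in> space M. \<theta> w \<in> H} \<partial>\<nu>)"
    by (rule emeasure_bind[OF ne]) measurable
  also have "\<dots> = (\<integral>\<^sup>+x. \<integral>\<^sup>+w. emeasure (L (z (\<theta> w))) H \<partial>L x \<partial>\<nu>)"
    by (intro nn_integral_cong) (simp add: shift_emeasure)
  also have "\<dots> = (\<integral>\<^sup>+w. emeasure (L (z (\<theta> w))) H \<partial>(\<nu> \<bind> L))"
    by (rule nn_integral_bind[symmetric, where B=M]) measurable
  also have "\<dots> = (\<integral>\<^sup>+x. emeasure (L x) H \<partial>distr (\<nu> \<bind> L) S (\<lambda>w. z (\<theta> w)))"
    by (rule nn_integral_distr[symmetric]) measurable
  also have "\<dots> = emeasure (\<nu> \<bind> L) H"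
    unfolding inv by (rule emeasure_bind[OF ne, symmetric]) measurable
  finally show "emeasure (distr (\<nu> \<bind> L) M \<theta>) H = emeasure (\<nu> \<bind> L) H" .
qed

definition stationary_law :: "'w measure" where
  "stationary_law = \<mu> \<bind> L"

definition segment_measure :: "'c measure" where
  "segment_measure = distr stationary_law C X"

lemma sets_stationary_law[measurable_cong, simp]: "sets stationary_law = sets M"
  unfolding stationary_law_def using space_S_nonempty by (intro sets_bind) (auto simp: sets_L)

lemma space_stationary_law[simp]: "space stationary_law = space M"
  by (rule sets_eq_imp_space_eq) simp

lemma prob_space_stationary_law: "prob_space stationary_law"
  unfolding stationary_law_def
  by (rule prob_space.prob_space_bind[OF prob_space_\<mu>, where S=M]) (auto simp: prob_space_L)

lemma sets_segment_measure[measurable_cong, simp]: "sets segment_measure = sets C"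
  by (simp add: segment_measure_def)

lemma prob_space_segment_measure: "prob_space segment_measure"
  unfolding segment_measure_def by (rule prob_space.prob_space_distr[OF prob_space_stationary_law]) simp

lemma emeasure_stationary_law:
  "A \<in> sets M \<Longrightarrow> emeasure stationary_law A = (\<integral>\<^sup>+x. emeasure (L x) A \<partial>\<mu>)"
  unfolding stationary_law_def using space_S_nonempty by (intro emeasure_bind) auto

lemma shift_stationary_law: "distr stationary_law M \<theta> = stationary_law"
  unfolding stationary_law_def
  by (rule shift_invariant_bind[OF prob_space_\<mu> sets_\<mu> invariant_\<mu>])

lemma upper_bound:
  assumes f: "f \<in> borel_measurable C" "integrable segment_measure f"
    and b: "(\<integral>c. f c \<partial>segment_measure) < b" and x: "x \<in> space S"
  shows "AE w in L x. \<exists>K::nat. \<forall>n. (\<Sum>j<n. f (X ((\<theta> ^^ j) w)) - b) \<le> real K"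
proof -
  note [measurable] = f(1)
  define s where "s n w = (\<Sum>j<n. f (X ((\<theta> ^^ j) w)) - b)" for n w
  \<comment> \<open>Unboundedness of the centred sums, unlike a bound on their averages at a given time, is
    exactly invariant under the shift; it contains the event that the upper limit of the averages exceeds \<open>b\<close>.\<close>
  define E where "E = {w \<in> space M. \<forall>K::nat. \<exists>n. real K < s n w}"
  have [measurable]: "s n \<in> borel_measurable M" for n unfolding s_def by measurable
  have E[measurable]: "E \<in> sets M" unfolding E_def by measurable
  have s_Suc: "s (Suc n) w = (f (X w) - b) + s n (\<theta> w)" for n w
    by (simp add: s_def sum.lessThan_Suc_shift funpow_swap1 del: sum.lessThan_Suc)
  have E_inv: "\<theta> w \<in> E \<longleftrightarrow> w \<in> E" if "w \<in> space M" for w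
  proof -
    \<comment> \<open>The sums along \<open>w\<close> and along \<open>\<theta> w\<close> differ by
      the single term \<open>f (X w) - b\<close>; enlarging the threshold by a bound
      \<open>N\<close> for it turns unboundedness of one into unboundedness of the other.\<close>
    obtain N :: nat where N: "\<bar>f (X w) - b\<bar> \<le> real N" using real_arch_simple by blast
    have "(\<forall>K::nat. \<exists>n. real K < s n (\<theta> w)) \<longleftrightarrow> (\<forall>K::nat. \<exists>n. real K < s n w)" (is "?l = ?r")
    proof
      assume l: ?l
      show ?r
      proof
        fix K :: nat
        obtain n where "real (K + N) < s n (\<theta> w)" using l by blast
        then have "real K < s (Suc n) w" using N by (simp add: s_Suc)
        then show "\<exists>n. real K < s n w" by blast
      qed
    next
      assume r: ?r
      show ?l
      proof
        fix K :: nat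
        obtain n where n: "real (K + N) < s n w" using r by blast
        \<comment> \<open>The empty sum is 0 and cannot exceed \<open>K + N\<close>, so there is a
          first summand to split off.\<close>
        then obtain i where i: "n = Suc i" by (cases n) (auto simp: s_def)
        then have "real K < s i (\<theta> w)" using n N by (simp add: s_Suc)
        then show "\<exists>n. real K < s n (\<theta> w)" by blast
      qed
    qed
    then show ?thesis using that measurable_space[OF \<theta>] by (simp add: E_def)
  qed
  define \<gamma> where "\<gamma> = measure (L x) E"
  have \<gamma>: "emeasure (L y) E = ennreal \<gamma>" if y: "y \<in> space S" for y
  proof -
    interpret prob_space "L y" by (rule prob_space_L[OF y])
    show ?thesis
      using invariant_event_le[OF E E_inv x y] invariant_event_le[OF E E_inv y x]
      by (simp add: emeasure_eq_measure \<gamma>_def)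
  qed
  \<comment> \<open>Invariance turns \<open>w \<in> E\<close> into
    \<open>\<theta> w \<in> E\<close>, an event of the future after the first segment. Given that
    segment its probability is \<gamma> whatever state has been reached, so it factors out.\<close>
  have ind: "emeasure stationary_law {w \<in> space M. X w \<in> G \<and> w \<in> E}
      = ennreal \<gamma> * emeasure stationary_law {w \<in> space M. X w \<in> G}"
    if G[measurable]: "G \<in> sets C" for G
  proof -
    have "emeasure (L y) {w \<in> space M. X w \<in> G \<and> w \<in> E} = ennreal \<gamma> * emeasure (L y) {w \<in> space M. X w \<in> G}"
      if y: "y \<in> space S" for y
    proof -
      have "{w \<in> space M. X w \<in> G \<and> w \<in> E} = {w \<in> space M. X w \<in> G \<and> \<theta> w \<in> E}"
        using E_inv by auto
      then have "emeasure (L y) {w \<in> space M. X w \<in> G \<and> w \<in> E}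
          = (\<integral>\<^sup>+w. emeasure (L (z (\<theta> w))) E * indicator {w \<in> space M. X w \<in> G} w \<partial>L y)"
        using markov[OF y G E] by simp
      also have "\<dots> = (\<integral>\<^sup>+w. ennreal \<gamma> * indicator {w \<in> space M. X w \<in> G} w \<partial>L y)"
        using measurable_space[OF \<theta>] measurable_space[OF z] y
        by (intro nn_integral_cong) (simp add: \<gamma> space_L)
      also have "\<dots> = ennreal \<gamma> * emeasure (L y) {w \<in> space M. X w \<in> G}"
        by (rule nn_integral_cmult_indicator) (use y in \<open>auto simp: sets_L\<close>)
      finally show ?thesis .
    qed
    then have "(\<integral>\<^sup>+y. emeasure (L y) {w \<in> space M. X w \<in> G \<and> w \<in> E} \<partial>\<mu>)
        = (\<integral>\<^sup>+y. ennreal \<gamma> * emeasure (L y) {w \<in> space M. X w \<in> G} \<partial>\<mu>)"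
      by (intro nn_integral_cong) simp
    also have "\<dots> = ennreal \<gamma> * (\<integral>\<^sup>+y. emeasure (L y) {w \<in> space M. X w \<in> G} \<partial>\<mu>)"
      by (rule nn_integral_cmult) measurable
    finally show ?thesis by (simp add: emeasure_stationary_law)
  qed
  let ?D = "density stationary_law (\<lambda>w. ennreal (indicator E w))"
  \<comment> \<open>Independence in the form of an identity of measures: the law of the first
    segment restricted to \<open>E\<close> is \<gamma> times its unrestricted law. Integrals of
    functions of \<open>X\<close> over \<open>E\<close> can then be read off.\<close>
  have law: "distr ?D C X = density segment_measure (\<lambda>_. ennreal \<gamma>)"
  proof (rule measure_eqI)
    fix G assume "G \<in> sets (distr ?D C X)"
    then have G[measurable]: "G \<in> sets C" by simp
    have "emeasure (distr ?D C X) G = emeasure ?D {w \<in> space M. X w \<in> G}"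
      by (subst emeasure_distr) (auto intro!: arg_cong[where f="emeasure ?D"])
    also have "\<dots> = emeasure stationary_law ({w \<in> space M. X w \<in> G} \<inter> E)"
      by (simp add: emeasure_density ennreal_indicator flip: indicator_inter_arith) (simp add: Int_commute indicator_inter_arith[symmetric])
    also have "\<dots> = emeasure stationary_law {w \<in> space M. X w \<in> G \<and> w \<in> E}"
      by (intro arg_cong[where f="emeasure stationary_law"]) auto
    also have "\<dots> = ennreal \<gamma> * emeasure segment_measure G"
      unfolding ind[OF G] segment_measure_def
      by (subst emeasure_distr) (auto intro!: arg_cong[where f="\<lambda>A. ennreal \<gamma> * emeasure stationary_law A"])
    also have "\<dots> = emeasure (density segment_measure (\<lambda>_. ennreal \<gamma>)) G"
      by (simp add: emeasure_density_const)
    finally show "emeasure (distr ?D C X) G = emeasure (density segment_measure (\<lambda>_. ennreal \<gamma>)) G" .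
  qed simp
  interpret m: prob_space segment_measure by (rule prob_space_segment_measure)
  interpret P: prob_space stationary_law by (rule prob_space_stationary_law)
  have fX: "integrable stationary_law (\<lambda>w. f (X w))"
    using f unfolding segment_measure_def by (subst (asm) integrable_distr_eq) auto
  have "0 \<le> (\<integral>w. (f (X w) - b) * indicator E w \<partial>stationary_law)"
  proof (rule integral_nonneg_of_positive_sums[where \<theta>=\<theta>])
    fix w assume "w \<in> E"
    then obtain n where "real 0 < s n w" unfolding E_def by blast
    then show "\<exists>n. 0 < (\<Sum>j<n. f (X ((\<theta> ^^ j) w)) - b)" by (auto simp: s_def)
  next
    show "distr stationary_law stationary_law \<theta> = stationary_law"
      using shift_stationary_law by (simp cong: distr_cong)
  qed (use fX E_inv in auto)
  also have "\<dots> = (\<integral>w. f (X w) - b \<partial>?D)"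
    by (subst integral_density) (auto simp: mult.commute)
  also have "\<dots> = (\<integral>c. f c - b \<partial>distr ?D C X)"
    by (subst integral_distr) auto
  also have "\<dots> = \<gamma> * ((\<integral>c. f c \<partial>segment_measure) - b)"
    unfolding law using f by (subst integral_density) (auto simp: \<gamma>_def m.prob_space)
  \<comment> \<open>A nonnegative \<gamma> times the negative number \<open>m(f) - b\<close> is
    nonnegative, where \<open>m(f)\<close> is the integral of \<open>f\<close> under
    \<open>segment_measure\<close>. Since \<gamma> is the probability of \<open>E\<close> from every
    starting point, \<open>E\<close> is null from the given \<open>x\<close>.\<close>
  finally have "\<gamma> = 0"
    using b measure_nonneg[of "L x" E] by (auto simp: \<gamma>_def zero_le_mult_iff)
  then have "E \<in> null_sets (L x)"
    using \<gamma>[OF x] x by (auto simp: sets_L)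
  then show ?thesis
    by (rule AE_I') (auto simp: E_def s_def space_L x not_le)
qed

text \<open>A bound \<open>K\<close> on the centred sums gives averages at most
  \<open>b + K/n\<close>. The levels \<open>b\<close> run through the integral plus
  \<open>1/(i+1)\<close>, countably many, so one exceptional null set serves all of them. Half of
  \<open>e\<close> pays for the level and half for \<open>K/n\<close>.\<close>

lemma limsup_bound:
  assumes f: "f \<in> borel_measurable C" "integrable segment_measure f"
    and x: "x \<in> space S"
  shows "AE w in L x. \<forall>e>0. \<forall>\<^sub>F n in sequentially.
    (\<Sum>j<n. f (X ((\<theta> ^^ j) w))) / real n \<le> (\<integral>c. f c \<partial>segment_measure) + e"
proof -
  let ?m = "\<integral>c. f c \<partial>segment_measure"
  have "AE w in L x. \<forall>i::nat. \<exists>K::nat. \<forall>n. (\<Sum>j<n. f (X ((\<theta> ^^ j) w)) - (?m + 1 / Suc i)) \<le> real K"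
    unfolding AE_all_countable by (intro allI upper_bound f x) simp
  then show ?thesis
  proof eventually_elim
    case (elim w)
    show ?case
    proof (intro allI impI)
      fix e :: real assume "0 < e"
      then obtain i where i: "1 / Suc i < e / 2"
        using nat_approx_posE[of "e / 2"] by auto
      define r where "r = 1 / real (Suc i)"
      obtain K :: nat where K: "\<And>n. (\<Sum>j<n. f (X ((\<theta> ^^ j) w)) - (?m + r)) \<le> real K"
        using elim unfolding r_def by blast
      obtain N :: nat where N: "2 * real K / e < real N" using reals_Archimedean2 by blast
      have "(\<Sum>j<n. f (X ((\<theta> ^^ j) w))) / real n \<le> ?m + e" if n: "n \<ge> Suc N" for n
      proof -
        have "2 * real K < e * real N" using N \<open>0 < e\<close> by (simp add: field_simps)
        also have "\<dots> \<le> e * real n" using n \<open>0 < e\<close> by simp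
        finally have "real K \<le> e / 2 * real n" by simp
        moreover have "(\<Sum>j<n. f (X ((\<theta> ^^ j) w))) \<le> real n * (?m + r) + real K"
          using K[of n] by (simp add: sum_subtractf)
        moreover have "real n * (?m + r) \<le> real n * (?m + e / 2)"
          using i unfolding r_def by (intro mult_left_mono) auto
        ultimately have "(\<Sum>j<n. f (X ((\<theta> ^^ j) w))) \<le> real n * (?m + e)"
          by (simp add: algebra_simps)
        then show ?thesis using n by (simp add: divide_le_eq mult.commute)
      qed
      then show "\<forall>\<^sub>F n in sequentially. (\<Sum>j<n. f (X ((\<theta> ^^ j) w))) / real n \<le> ?m + e"
        by (auto simp: eventually_sequentially)
    qed
  qed
qed

lemma law_of_large_numbers:
  assumes f: "f \<in> borel_measurable C" "integrable segment_measure f"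
    and x: "x \<in> space S"
  shows "AE w in L x. (\<lambda>n. (\<Sum>j<n. f (X ((\<theta> ^^ j) w))) / real n) \<longlonglongrightarrow> (\<integral>c. f c \<partial>segment_measure)"
proof -
  have f': "(\<lambda>c. - f c) \<in> borel_measurable C" "integrable segment_measure (\<lambda>c. - f c)"
    using f by auto
  show ?thesis
    using limsup_bound[OF f x] limsup_bound[OF f' x]
  proof eventually_elim
    case (elim w)
    show ?case
    proof (rule tendstoI)
      fix e :: real assume "0 < e"
      then have "0 < e / 2" by simp
      with elim have
        "\<forall>\<^sub>F n in sequentially. (\<Sum>j<n. f (X ((\<theta> ^^ j) w))) / real n
          \<le> (\<integral>c. f c \<partial>segment_measure) + e / 2"
        "\<forall>\<^sub>F n in sequentially. (\<Sum>j<n. - f (X ((\<theta> ^^ j) w))) / real n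
          \<le> (\<integral>c. - f c \<partial>segment_measure) + e / 2"
        by blast+
      then show "\<forall>\<^sub>F n in sequentially.
          dist ((\<Sum>j<n. f (X ((\<theta> ^^ j) w))) / real n) (\<integral>c. f c \<partial>segment_measure) < e"
      proof eventually_elim
        case (elim n)
        then show ?case using \<open>0 < e\<close> by (simp add: dist_real_def sum_negf)
      qed
    qed
  qed
qed

text \<open>Two evaluations of the mean frequency of visits of the segments to \<open>G\<close>
  under the path law with initial law \<nu>. It tends to \<open>segment_measure G\<close> by the law
  of large numbers, valid from every initial value and hence under any mixture; and by stationarity
  it equals the probability of \<open>X w \<in> G\<close> for every positive
  \<open>n\<close>.\<close>

lemma segment_law_unique:
  assumes \<nu>: "prob_space \<nu>" and sets_\<nu>[measurable_cong, simp]: "sets \<nu> = sets S"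
    and inv: "distr (\<nu> \<bind> L) S (\<lambda>w. z (\<theta> w)) = \<nu>"
  shows "distr (\<nu> \<bind> L) C X = segment_measure"
proof (rule measure_eqI)
  interpret \<nu>: prob_space \<nu> by fact
  have sp[simp]: "space \<nu> = space S" by (rule sets_eq_imp_space_eq) simp
  have ne: "space \<nu> \<noteq> {}" by (rule \<nu>.not_empty)
  define P where "P = \<nu> \<bind> L"
  have sets_P[measurable_cong]: "sets P = sets M"
    unfolding P_def by (rule sets_bind[OF _ ne]) (simp add: sets_L)
  have space_P: "space P = space M" by (rule sets_eq_imp_space_eq) fact
  interpret P: prob_space P
    unfolding P_def by (rule \<nu>.prob_space_bind[where S=M]) (auto simp: prob_space_L)
  interpret m: prob_space segment_measure by (rule prob_space_segment_measure)
  have shift: "distr P P \<theta> = P"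
    using shift_invariant_bind[OF \<nu> sets_\<nu> inv] sets_P by (simp add: P_def cong: distr_cong)
  fix G assume "G \<in> sets (distr (\<nu> \<bind> L) C X)"
  then have G[measurable]: "G \<in> sets C" by simp
  define u where "u n w = (\<Sum>j<n. indicat_real G (X ((\<theta> ^^ j) w))) / real n" for n w
  have [measurable]: "u n \<in> borel_measurable M" for n unfolding u_def by measurable
  have "AE w in L x. (\<lambda>n. u n w) \<longlonglongrightarrow> measure segment_measure G" if "x \<in> space S" for x
    using law_of_large_numbers[of "indicat_real G" x] that
    by (simp add: u_def m.emeasure_eq_measure)
  then have lim: "AE w in P. (\<lambda>n. u n w) \<longlonglongrightarrow> measure segment_measure G"
    unfolding P_def by (subst AE_bind[where B=M]) auto
  have u1: "\<bar>u n w\<bar> \<le> 1" for n w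
  proof -
    have "(\<Sum>j<n. indicat_real G (X ((\<theta> ^^ j) w))) \<le> (\<Sum>j<n. 1)"
      by (intro sum_mono) (simp add: indicator_def)
    then show ?thesis by (simp add: u_def divide_le_eq sum_nonneg)
  qed
  have "(\<lambda>n. \<integral>w. u n w \<partial>P) \<longlonglongrightarrow> (\<integral>w. measure segment_measure G \<partial>P)"
    by (rule integral_dominated_convergence[where w="\<lambda>_. 1"]) (use lim u1 in auto)
  moreover have "(\<integral>w. u n w \<partial>P) = measure P {w \<in> space M. X w \<in> G}" if "n > 0" for n
  proof -
    have int: "integrable P (\<lambda>w. indicat_real G (X ((\<theta> ^^ j) w)))" for j
      by (rule P.integrable_const_bound[where B=1]) (auto simp: indicator_def)
    have "(\<integral>w. indicat_real G (X ((\<theta> ^^ j) w)) \<partial>P) = measure P {w \<in> space M. X w \<in> G}" for j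
    proof (induction j)
      case 0
      have "(\<integral>w. indicat_real G (X w) \<partial>P) = (\<integral>w. indicat_real {w \<in> space M. X w \<in> G} w \<partial>P)"
        by (intro Bochner_Integration.integral_cong) (auto simp: space_P indicator_def)
      then show ?case by (simp add: space_P)
    next
      case (Suc j)
      then show ?case
        using integrable_compose_invariant(2)[OF _ shift int[of j]] by (simp add: funpow_swap1)
    qed
    then have "(\<integral>w. u n w \<partial>P) = (\<Sum>j<n. measure P {w \<in> space M. X w \<in> G}) / real n"
      unfolding u_def using int by simp
    with that show ?thesis by simp
  qed
  then have "(\<lambda>n. \<integral>w. u n w \<partial>P) \<longlonglongrightarrow> measure P {w \<in> space M. X w \<in> G}"
    by (intro tendsto_eventually eventually_sequentiallyI[of 1]) auto
  ultimately have "measure P {w \<in> space M. X w \<in> G} = measure segment_measure G"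
    using LIMSEQ_unique by (force simp: P.prob_space)
  moreover have "emeasure (distr P C X) G = emeasure P {w \<in> space M. X w \<in> G}"
    by (subst emeasure_distr) (auto simp: space_P intro!: arg_cong[where f="emeasure P"])
  ultimately show "emeasure (distr (\<nu> \<bind> L) C X) G = emeasure segment_measure G"
    by (simp add: P_def[symmetric] P.emeasure_eq_measure m.emeasure_eq_measure)
qed simp

end

section \<open>Spaces of continuous paths\<close>

text \<open>The \<sigma>-field is the trace of the product \<sigma>-field, so that identities of
  measures can be checked on finitely many times. With index set \<open>{0..}\<close> it carries
  whole trajectories, with \<open>{0..T}\<close> it gives the \<sigma>-field of
  \<open>C_space T\<close>.\<close>

definition path_space :: "real set \<Rightarrow> (real \<Rightarrow> real) measure" where
  "path_space I = restrict_space (PiM I (\<lambda>_. borel)) {w. continuous_on I w}"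

lemma space_path_space: "space (path_space I) = {w. continuous_on I w \<and> w \<in> extensional I}"
  by (auto simp: path_space_def space_restrict_space space_PiM PiE_def)

lemma measurable_path_space_component:
  "s \<in> I \<Longrightarrow> (\<lambda>w. w s) \<in> borel_measurable (path_space I)"
  unfolding path_space_def by (intro measurable_restrict_space1) measurable

lemma measurable_path_space:
  assumes "\<And>w. w \<in> space N \<Longrightarrow> f w \<in> space (path_space I)"
    and "\<And>s. s \<in> I \<Longrightarrow> (\<lambda>w. f w s) \<in> borel_measurable N"
  shows "f \<in> N \<rightarrow>\<^sub>M path_space I"
  unfolding path_space_def using assms
  by (intro measurable_restrict_space2 measurable_PiM_single')
     (auto simp: space_path_space PiE_def)

definition bernstein_interp :: "real \<Rightarrow> rat list \<Rightarrow> real \<Rightarrow> real" where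
  "bernstein_interp T q s = (\<Sum>k\<le>length q - 1. of_rat (q ! k) * Bernstein (length q - 1) k (s / T))"

lemma continuous_bernstein_interp: "continuous_on A (bernstein_interp T q)"
  unfolding bernstein_interp_def Bernstein_def by (cases "T = 0") (auto intro!: continuous_intros)

text \<open>Half of \<open>e\<close> covers the Bernstein approximation of the rescaled function and
  half the rounding of its node values to rationals. Bernstein weights are nonnegative and sum to 1,
  so rounding does not accumulate.\<close>

lemma bernstein_interp_dense:
  assumes "0 < T" and \<alpha>: "continuous_on {0..T} \<alpha>" and "0 < e"
  shows "\<exists>q. \<forall>s\<in>{0..T}. \<bar>\<alpha> s - bernstein_interp T q s\<bar> \<le> e"
proof -
  have "continuous_on {0..1} (\<lambda>x. \<alpha> (T * x))"
    by (rule continuous_on_compose2[OF \<alpha>])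
       (use \<open>0 < T\<close> in \<open>auto intro!: continuous_intros simp: mult_le_cancel_left2\<close>)
  from Bernstein_Weierstrass[OF this, of "e / 2"] \<open>0 < e\<close> obtain n where
    n: "\<And>x. x \<in> {0..1} \<Longrightarrow> \<bar>\<alpha> (T * x) - (\<Sum>k\<le>n. \<alpha> (T * (k/n)) * Bernstein n k x)\<bar> < e / 2"
    by auto
  have "\<exists>r. \<bar>\<alpha> (T * (k/n)) - of_rat r\<bar> < e / 2" for k :: nat
  proof -
    obtain r where "\<alpha> (T * (k/n)) - e/2 < of_rat r" "of_rat r < \<alpha> (T * (k/n)) + e/2"
      using of_rat_dense[of "\<alpha> (T * (k/n)) - e/2" "\<alpha> (T * (k/n)) + e/2"] \<open>0 < e\<close> by auto
    then show ?thesis by (intro exI[of _ r]) linarith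
  qed
  then obtain r where r: "\<And>k::nat. \<bar>\<alpha> (T * (k/n)) - of_rat (r k)\<bar> < e / 2" by metis
  define q where "q = map r [0..<Suc n]"
  have "\<bar>\<alpha> s - bernstein_interp T q s\<bar> \<le> e" if s: "s \<in> {0..T}" for s
  proof -
    define x where "x = s / T"
    have x: "x \<in> {0..1}" "T * x = s" using s \<open>0 < T\<close> by (auto simp: x_def)
    have B: "0 \<le> Bernstein n k x" for k using x by (intro Bernstein_nonneg) auto
    have q: "bernstein_interp T q s = (\<Sum>k\<le>n. of_rat (r k) * Bernstein n k x)"
      by (auto simp: bernstein_interp_def q_def x_def nth_map_upt intro!: sum.cong simp del: upt_Suc)
    have "\<bar>(\<Sum>k\<le>n. \<alpha> (T * (k/n)) * Bernstein n k x) - bernstein_interp T q s\<bar>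
        = \<bar>\<Sum>k\<le>n. (\<alpha> (T * (k/n)) - of_rat (r k)) * Bernstein n k x\<bar>"
      by (simp add: q sum_subtractf algebra_simps)
    also have "\<dots> \<le> (\<Sum>k\<le>n. \<bar>(\<alpha> (T * (k/n)) - of_rat (r k)) * Bernstein n k x\<bar>)"
      by (rule sum_abs)
    also have "\<dots> \<le> (\<Sum>k\<le>n. e / 2 * Bernstein n k x)"
    proof (rule sum_mono)
      fix k
      show "\<bar>(\<alpha> (T * (k/n)) - of_rat (r k)) * Bernstein n k x\<bar> \<le> e / 2 * Bernstein n k x"
        using mult_right_mono[OF less_imp_le[OF r[of k]] B[of k]]
        by (simp only: abs_mult abs_of_nonneg[OF B])
    qed
    also have "\<dots> = e / 2" by (simp only: sum_distrib_left[symmetric] sum_Bernstein mult_1_right)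
    finally show ?thesis using n[OF x(1)] unfolding x(2) by linarith
  qed
  then show ?thesis by blast
qed

text \<open>Bernstein polynomials with rational coefficients are a countable dense family, so open sets are
  countable unions of closed balls, and these are described by countably many coordinates.\<close>

lemma sets_C_space:
  assumes "0 < T"
  shows "sets (C_space T) = sets (path_space {0..T})"
proof
  let ?C = "mspace (C_metric T)" and ?d = "mdist (C_metric T)"
  interpret M: Metric_space ?C ?d by (rule Metric_space_mspace_mdist)
  have space_C: "space (C_space T) = ?C"
    by (simp add: C_space_def space_measure_of_conv)
  have space_eq: "?C = space (path_space {0..T})"
    using space_C by (simp add: space_C_space space_path_space)
  have top: "mtopology_of (C_metric T) = M.mtopology" by (simp add: mtopology_of_def)
  have sets_C: "sets (C_space T) = sigma_sets ?C {U. openin M.mtopology U}"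
    unfolding C_space_def top by (rule sets_measure_of) (use openin_subset[of M.mtopology] in auto)
  have d_le: "?d f g \<le> a \<longleftrightarrow> (\<forall>x\<in>{0..T}. \<bar>f x - g x\<bar> \<le> a)" if "f \<in> ?C" "g \<in> ?C" for f g a
    using cfunspace_mdist_le[of f "top_of_set {0..T}" euclidean_metric g a] that \<open>0 < T\<close>
    by (simp add: C_metric_def dist_real_def)
  have "sigma_sets (space (path_space {0..T})) {U. openin M.mtopology U} \<subseteq> sets (path_space {0..T})"
  proof (rule sets.sigma_sets_subset, rule subsetI)
    fix U assume "U \<in> {U. openin M.mtopology U}"
    then have U: "openin M.mtopology U" by simp
    define D where "D q r = {\<alpha> \<in> space (path_space {0..T}).
      \<forall>s\<in>{0..T}. \<bar>\<alpha> s - bernstein_interp T q s\<bar> \<le> of_rat r}" for q r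
    have D: "D q r \<in> sets (path_space {0..T})" for q r
    proof -
      \<comment> \<open>A weak inequality between continuous functions extends from a dense set to
        its closure, so the uniform condition defining \<open>D q r\<close> is a countable
        intersection of conditions on coordinates.\<close>
      obtain J where J: "countable J" "J \<subseteq> {0..T}" "{0..T} \<subseteq> closure J"
        using separable[of "{0..T}"] by blast
      have cl: "closure J = {0..T}"
        using J closure_minimal[of J "{0..T}"] by auto
      have "D q r = {\<alpha> \<in> space (path_space {0..T}). \<forall>s\<in>J. \<bar>\<alpha> s - bernstein_interp T q s\<bar> \<le> of_rat r}"
      proof (intro set_eqI iffI)
        fix \<alpha> assume a: "\<alpha> \<in> {\<alpha> \<in> space (path_space {0..T}). \<forall>s\<in>J. \<bar>\<alpha> s - bernstein_interp T q s\<bar> \<le> of_rat r}"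
        then have "continuous_on (closure J) (\<lambda>s. \<bar>\<alpha> s - bernstein_interp T q s\<bar>)"
          unfolding cl by (auto simp: space_path_space intro!: continuous_intros continuous_bernstein_interp)
        from continuous_le_on_closure[OF this] a show "\<alpha> \<in> D q r"
          unfolding D_def cl by blast
      qed (use J in \<open>auto simp: D_def\<close>)
      moreover have "(\<lambda>\<alpha>. \<bar>\<alpha> s - bernstein_interp T q s\<bar>) \<in> borel_measurable (path_space {0..T})" if "s \<in> J" for s
        using J that by (intro borel_measurable_abs borel_measurable_diff measurable_path_space_component) auto
      ultimately show ?thesis
        using J(1) by (auto intro!: sets.sets_Collect_countable_Ball borel_measurable_le)
    qed
    have "U = (\<Union>(q, r)\<in>{(q, r). D q r \<subseteq> U}. D q r)"
    proof (intro set_eqI iffI)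
      fix \<alpha> assume \<alpha>: "\<alpha> \<in> U"
      then obtain e where e: "0 < e" "M.mball \<alpha> e \<subseteq> U"
        using U M.openin_mtopology by blast
      have \<alpha>C: "\<alpha> \<in> ?C" using \<alpha> openin_subset[OF U] by auto
      \<comment> \<open>Any element of \<open>D q r\<close> and \<alpha> itself are both within
        \<open>r\<close> of the polynomial, hence within \<open>2 * r\<close> of each other, which
        must stay below \<open>e\<close>.\<close>
      obtain r where r: "0 < real_of_rat r" "real_of_rat r < e / 2"
        using of_rat_dense[of 0 "e/2"] e by auto
      obtain q where q: "\<forall>s\<in>{0..T}. \<bar>\<alpha> s - bernstein_interp T q s\<bar> \<le> of_rat r"
        using bernstein_interp_dense[OF \<open>0 < T\<close> _ r(1), of \<alpha>] \<alpha>C by (auto simp: space_eq space_path_space)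
      have "D q r \<subseteq> U"
      proof
        fix \<beta> assume b: "\<beta> \<in> D q r"
        then have \<beta>C: "\<beta> \<in> ?C" by (simp add: D_def space_eq)
        have "\<bar>\<alpha> s - \<beta> s\<bar> \<le> 2 * of_rat r" if "s \<in> {0..T}" for s
          using q b that unfolding D_def by fastforce
        then have "?d \<alpha> \<beta> \<le> 2 * of_rat r" using d_le[OF \<alpha>C \<beta>C] by blast
        then have "\<beta> \<in> M.mball \<alpha> e" using r \<alpha>C \<beta>C by simp
        then show "\<beta> \<in> U" using e by blast
      qed
      moreover have "\<alpha> \<in> D q r" using q \<alpha>C by (simp add: D_def space_eq)
      ultimately show "\<alpha> \<in> (\<Union>(q, r)\<in>{(q, r). D q r \<subseteq> U}. D q r)" by blast
    qed auto
    also have "\<dots> \<in> sets (path_space {0..T})"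
      using D by (intro sets.countable_UN') auto
    finally show "U \<in> sets (path_space {0..T})" .
  qed
  then show "sets (C_space T) \<subseteq> sets (path_space {0..T})"
    unfolding sets_C space_eq .
  \<comment> \<open>The converse inclusion: evaluations at points are continuous for the uniform
    metric, and they generate the \<sigma>-field of the path space.\<close>
  have "(\<lambda>w. w) \<in> C_space T \<rightarrow>\<^sub>M path_space {0..T}"
  proof (rule measurable_path_space)
    fix s assume s: "s \<in> {0..T}"
    show "(\<lambda>w. w s) \<in> borel_measurable (C_space T)"
    proof (rule borel_measurableI)
      fix V :: "real set" assume V: "open V"
      have "openin M.mtopology {w \<in> ?C. w s \<in> V}"
        unfolding M.openin_mtopology
      proof safe
        fix w assume w: "w \<in> ?C" "w s \<in> V"
        then obtain e where e: "0 < e" "ball (w s) e \<subseteq> V" using V openE by blast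
        have "M.mball w e \<subseteq> {w \<in> ?C. w s \<in> V}"
        proof
          fix v assume v: "v \<in> M.mball w e"
          then have "\<bar>w s - v s\<bar> \<le> ?d w v" using d_le[of w v "?d w v"] s by auto
          also have "\<dots> < e" using v by simp
          finally have "v s \<in> ball (w s) e" by (simp add: dist_real_def)
          with e v show "v \<in> {w \<in> ?C. w s \<in> V}" by auto
        qed
        with e show "\<exists>r>0. M.mball w r \<subseteq> {w \<in> ?C. w s \<in> V}" by blast
      qed
      moreover have "(\<lambda>w. w s) -` V \<inter> space (C_space T) = {w \<in> ?C. w s \<in> V}"
        by (auto simp: space_C)
      ultimately show "(\<lambda>w. w s) -` V \<inter> space (C_space T) \<in> sets (C_space T)"
        unfolding sets_C by auto
    qed
  qed (simp add: space_C space_eq)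
  from measurable_sets[OF this] show "sets (path_space {0..T}) \<subseteq> sets (C_space T)"
    using sets.sets_into_space[of _ "path_space {0..T}"] by (auto simp: space_C space_eq Int_absorb2)
qed

section \<open>The Markov property on path space\<close>

lemma space_generated_algebra[simp]: "space (generated_algebra \<Omega> S I Z) = \<Omega>"
  unfolding generated_algebra_def by (simp add: space_measure_of_conv)

lemma sets_generated_algebra:
  "sets (generated_algebra \<Omega> S I Z) = sigma_sets \<Omega> (\<Union>i\<in>I. {Z i -` B \<inter> \<Omega> | B. B \<in> sets S})"
  unfolding generated_algebra_def by (rule sets_measure_of) auto

lemma sets_generated_algebra_subset:
  assumes "\<And>i. i \<in> I \<Longrightarrow> Z i \<in> N \<rightarrow>\<^sub>M S" and "space N = \<Omega>"
  shows "sets (generated_algebra \<Omega> S I Z) \<subseteq> sets N"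
  unfolding sets_generated_algebra assms(2)[symmetric]
  using assms(1) by (intro sets.sigma_sets_subset) (auto intro: measurable_sets)

lemma measurable_generated_algebra:
  assumes "i \<in> I" and "Z i \<in> \<Omega> \<rightarrow> space S"
  shows "Z i \<in> generated_algebra \<Omega> S I Z \<rightarrow>\<^sub>M S"
  using assms by (intro measurableI) (auto simp: sets_generated_algebra)

text \<open>Puts an arbitrary finite set of times into the increasing form starting at 0 that
  \<open>cylinder_integral\<close> expects.\<close>

lemma finite_set_enumeration:
  fixes J :: "real set"
  assumes "finite J" and "0 \<in> J" and "J \<subseteq> {0..}"
  shows "\<exists>n t. t 0 = 0 \<and> (\<forall>i<n. t i < t (Suc i)) \<and> t ` {..n} = J"
proof -
  define xs where "xs = sorted_list_of_set J"
  have xs: "set xs = J" "sorted_wrt (<) xs"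
    using assms(1) by (auto simp: xs_def)
  have ne: "xs \<noteq> []" using xs(1) assms(2) by auto
  define n where "n = length xs - 1"
  have n: "Suc n = length xs" using ne by (simp add: n_def)
  have img: "(!) xs ` {..n} = J"
    using xs(1) n by (auto simp: set_conv_nth image_iff less_Suc_eq_le[symmetric])
  have less: "xs ! i < xs ! j" if "i < j" "j \<le> n" for i j
    using sorted_wrt_nth_less[OF xs(2) that(1)] that(2) n by auto
  obtain i where i: "i \<le> n" "xs ! i = 0" using img assms(2) by fastforce
  have "xs ! 0 \<le> xs ! i" using less[of 0 i] i(1) by (cases "i = 0") auto
  moreover have "0 \<le> xs ! 0" using img assms(3) by fastforce
  ultimately have "xs ! 0 = 0" using i by simp
  then show ?thesis
    using less img by (intro exI[of _ n] exI[of _ "(!) xs"]) auto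
qed

locale periodic_markov =
  fixes T :: real
    and \<A> :: "'w measure"
    and P :: "real \<Rightarrow> 'w measure"
    and \<xi> :: "real \<Rightarrow> 'w \<Rightarrow> real"
    and p :: "real \<Rightarrow> real \<Rightarrow> real \<Rightarrow> real \<Rightarrow> real"
  assumes T_pos: "0 < T"
    and process: "continuous_markov_process \<A> P \<xi> p"
    and periodic: "periodic_densities T p"
begin

abbreviation "\<F> \<equiv> natural_filtration \<A> \<xi>"

lemma \<xi>_measurable[measurable]: "0 \<le> t \<Longrightarrow> \<xi> t \<in> borel_measurable \<A>"
  and \<xi>_continuous: "\<omega> \<in> space \<A> \<Longrightarrow> continuous_on {0..} (\<lambda>t. \<xi> t \<omega>)"
  and prob_space_P: "prob_space (P x)"
  and sets_P[measurable_cong, simp]: "sets (P x) = sets \<A>"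
  and \<xi>_start: "AE \<omega> in P x. \<xi> 0 \<omega> = x"
  and cond_exp_\<xi>: "0 \<le> s \<Longrightarrow> s < t \<Longrightarrow> B \<in> sets borel \<Longrightarrow> AE \<omega> in P x.
      real_cond_exp (P x) (\<F> s) (\<lambda>\<omega>. indicator B (\<xi> t \<omega>)) \<omega> = measure (trans_kernel p s t (\<xi> s \<omega>)) B"
  and densities: "transition_densities p"
  using process by (auto simp: continuous_markov_process_def)

lemma space_P[simp]: "space (P x) = space \<A>"
  by (rule sets_eq_imp_space_eq) simp

lemma sets_\<F>_subset: "sets (\<F> s) \<subseteq> sets \<A>"
  by (rule sets_generated_algebra_subset) auto

lemma \<F>_measurable: "0 \<le> t \<Longrightarrow> t \<le> s \<Longrightarrow> \<xi> t \<in> borel_measurable (\<F> s)"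
  by (rule measurable_generated_algebra) auto

lemma \<F>_mono: "s \<le> t \<Longrightarrow> sets (\<F> s) \<subseteq> sets (\<F> t)"
  by (rule sets_generated_algebra_subset) (auto intro: \<F>_measurable)

lemma \<F>_subalgebra: "sigma_finite_subalgebra (P x) (\<F> s)"
proof -
  interpret prob_space "P x" by (rule prob_space_P)
  have "finite_measure_subalgebra (P x) (\<F> s)"
    by unfold_locales (use sets_\<F>_subset in \<open>simp add: subalgebra_def\<close>)
  then show ?thesis by (rule finite_measure_subalgebra_is_sigma_finite)
qed

lemma sets_trans_kernel[simp]: "sets (trans_kernel p s t x) = sets borel"
  and space_trans_kernel[simp]: "space (trans_kernel p s t x) = UNIV"
  by (simp_all add: trans_kernel_def)

lemma prob_space_trans_kernel: "0 \<le> s \<Longrightarrow> s < t \<Longrightarrow> prob_space (trans_kernel p s t x)"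
  using densities by (simp add: transition_densities_def)

lemma trans_kernel_measurable:
  assumes "0 \<le> s" and "s < t"
  shows "trans_kernel p s t \<in> borel \<rightarrow>\<^sub>M prob_algebra borel"
proof (intro measurable_prob_algebraI measurable_subprob_algebra)
  fix B :: "real set" assume [measurable]: "B \<in> sets borel"
  have p: "(\<lambda>(x, y). p s t x y) \<in> borel_measurable (borel \<Otimes>\<^sub>M borel)"
    using densities assms by (simp add: transition_densities_def)
  then have [measurable]: "(\<lambda>y. p s t x y) \<in> borel_measurable borel" for x
    by measurable
  have [measurable]: "(\<lambda>(x, y). p s t x y) \<in> borel_measurable (borel \<Otimes>\<^sub>M lborel)"
    using p by (simp cong: measurable_cong_sets)
  have "(\<lambda>x. \<integral>\<^sup>+y. ennreal (p s t x y) * indicator B y \<partial>lborel) \<in> borel_measurable borel"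
    by measurable
  then show "(\<lambda>x. emeasure (trans_kernel p s t x) B) \<in> borel_measurable borel"
    by (simp add: trans_kernel_def emeasure_density)
qed (use prob_space_trans_kernel[OF assms] in \<open>auto intro: prob_space_imp_subprob_space\<close>)

text \<open>Periodicity of the densities enters through this identity; everything time homogeneous
  about the blocks of length \<open>T\<close> derives from it.\<close>

lemma trans_kernel_shift:
  "0 \<le> s \<Longrightarrow> s < t \<Longrightarrow> trans_kernel p (real k * T + s) (real k * T + t) = trans_kernel p s t"
  using periodic by (simp add: periodic_densities_def trans_kernel_def fun_eq_iff)

text \<open>The hypothesis on the process concerns conditional expectations of indicators. It is
  upgraded to nonnegative functions by an identity of measures: under \<open>P x\<close> restricted
  to \<open>G\<close>, the law of \<open>\<xi> t\<close> is the mixture of the transition kernels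
  over the state at time \<open>s\<close>.\<close>

lemma markov_step:
  assumes st: "0 \<le> s" "s < t" and G: "G \<in> sets (\<F> s)" and f[measurable]: "f \<in> borel_measurable borel"
  shows "(\<integral>\<^sup>+\<omega>. f (\<xi> t \<omega>) * indicator G \<omega> \<partial>P x)
    = (\<integral>\<^sup>+\<omega>. (\<integral>\<^sup>+y. f y \<partial>trans_kernel p s t (\<xi> s \<omega>)) * indicator G \<omega> \<partial>P x)"
proof -
  interpret P: prob_space "P x" by (rule prob_space_P)
  interpret F: sigma_finite_subalgebra "P x" "\<F> s" by (rule \<F>_subalgebra)
  have [measurable]: "G \<in> sets \<A>" using G sets_\<F>_subset by blast
  have [measurable]: "\<xi> s \<in> borel_measurable \<A>" "\<xi> t \<in> borel_measurable \<A>" using st by auto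
  have K: "trans_kernel p s t \<in> borel \<rightarrow>\<^sub>M subprob_algebra borel"
    using trans_kernel_measurable[OF st] by (rule measurable_prob_algebraD)
  let ?D = "density (P x) (indicator G)"
  let ?N = "\<lambda>\<omega>. trans_kernel p s t (\<xi> s \<omega>)"
  have N[measurable]: "?N \<in> \<A> \<rightarrow>\<^sub>M subprob_algebra borel"
    by (rule measurable_compose[OF _ K]) measurable
  have ne: "space \<A> \<noteq> {}" using P.not_empty by simp
  have "distr ?D borel (\<xi> t) = ?D \<bind> ?N"
  proof (rule measure_eqI)
    show "sets (distr ?D borel (\<xi> t)) = sets (?D \<bind> ?N)"
      using ne by (subst sets_bind) auto
    fix B :: "real set" assume "B \<in> sets (distr ?D borel (\<xi> t))"
    then have B[measurable]: "B \<in> sets borel" by simp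
    have N_real: "emeasure (?N \<omega>) B = ennreal (measure (?N \<omega>) B)" for \<omega>
      using prob_space_trans_kernel[OF st, of "\<xi> s \<omega>"]
      by (simp add: finite_measure.emeasure_eq_measure prob_space_def)
    have N_le: "measure (?N \<omega>) B \<le> 1" for \<omega>
      using prob_space_trans_kernel[OF st, of "\<xi> s \<omega>"] by (rule prob_space.prob_le_1)
    have [measurable]: "(\<lambda>\<omega>. measure (?N \<omega>) B) \<in> borel_measurable \<A>"
      by measurable
    \<comment> \<open>Conditional expectations are real valued, so the computation passes through
      Bochner integrals of bounded functions and back.\<close>
    have int1: "integrable (P x) (\<lambda>\<omega>. indicat_real B (\<xi> t \<omega>))"
      by (rule P.integrable_const_bound[where B=1]) (auto simp: indicator_def)
    have int2: "integrable (P x) (\<lambda>\<omega>. indicat_real G \<omega> * indicat_real B (\<xi> t \<omega>))"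
      by (rule P.integrable_const_bound[where B=1]) (auto simp: indicator_def)
    have int3: "integrable (P x) (\<lambda>\<omega>. indicat_real G \<omega> * measure (?N \<omega>) B)"
      by (rule P.integrable_const_bound[where B=1]) (auto simp: indicator_def N_le)
    have "emeasure (distr ?D borel (\<xi> t)) B
        = (\<integral>\<^sup>+\<omega>. ennreal (indicat_real G \<omega> * indicat_real B (\<xi> t \<omega>)) \<partial>P x)"
      by (subst emeasure_distr)
         (auto simp: emeasure_density indicator_def intro!: nn_integral_cong)
    also have "\<dots> = ennreal (\<integral>\<omega>. indicat_real G \<omega> * indicat_real B (\<xi> t \<omega>) \<partial>P x)"
      by (rule nn_integral_eq_integral[OF int2]) simp
    also have "(\<integral>\<omega>. indicat_real G \<omega> * indicat_real B (\<xi> t \<omega>) \<partial>P x)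
        = (\<integral>\<omega>. indicat_real G \<omega> * real_cond_exp (P x) (\<F> s) (\<lambda>\<omega>. indicator B (\<xi> t \<omega>)) \<omega> \<partial>P x)"
      using F.real_cond_exp_intA[OF int1 G] by (simp add: set_lebesgue_integral_def)
    also have "\<dots> = (\<integral>\<omega>. indicat_real G \<omega> * measure (?N \<omega>) B \<partial>P x)"
      using cond_exp_\<xi>[OF st B, of x] by (intro integral_cong_AE) auto
    also have "ennreal \<dots> = (\<integral>\<^sup>+\<omega>. ennreal (indicat_real G \<omega> * measure (?N \<omega>) B) \<partial>P x)"
      by (rule nn_integral_eq_integral[OF int3, symmetric]) simp
    also have "\<dots> = (\<integral>\<^sup>+\<omega>. emeasure (?N \<omega>) B \<partial>?D)"
      by (subst nn_integral_density) (auto simp: N_real indicator_def intro!: nn_integral_cong)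
    also have "\<dots> = emeasure (?D \<bind> ?N) B"
      using ne by (intro emeasure_bind[symmetric, where N=borel]) auto
    finally show "emeasure (distr ?D borel (\<xi> t)) B = emeasure (?D \<bind> ?N) B" .
  qed
  then have "(\<integral>\<^sup>+y. f y \<partial>distr ?D borel (\<xi> t)) = (\<integral>\<^sup>+y. f y \<partial>(?D \<bind> ?N))" by simp
  also have "(\<integral>\<^sup>+y. f y \<partial>(?D \<bind> ?N)) = (\<integral>\<^sup>+\<omega>. (\<integral>\<^sup>+y. f y \<partial>?N \<omega>) \<partial>?D)"
    by (rule nn_integral_bind[where B=borel]) auto
  also have "\<dots> = (\<integral>\<^sup>+\<omega>. (\<integral>\<^sup>+y. f y \<partial>?N \<omega>) * indicator G \<omega> \<partial>P x)"
    using measurable_compose[OF N nn_integral_measurable_subprob_algebra[OF f]]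
    by (subst nn_integral_density) (auto simp: mult.commute)
  finally show ?thesis
    by (simp add: nn_integral_distr nn_integral_density mult.commute)
qed

lemma cylinder_integral_measurable:
  assumes "0 \<le> t i" and "\<And>j. j < n \<Longrightarrow> t (i + j) < t (i + Suc j)"
    and "\<And>j. j \<le> n \<Longrightarrow> B (i + j) \<in> sets borel"
  shows "cylinder_integral p t B i n \<in> borel_measurable borel"
  using assms
proof (induction n arbitrary: i)
  case 0
  have [measurable]: "B i \<in> sets borel" using "0.prems"(3)[of 0] by simp
  show ?case by (simp add: fun_eq_iff)
next
  case (Suc n)
  have [measurable]: "B i \<in> sets borel" using Suc.prems(3)[of 0] by simp
  have lt: "t i < t (Suc i)" using Suc.prems(2)[of 0] by simp
  have IH[measurable]: "cylinder_integral p t B (Suc i) n \<in> borel_measurable borel"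
  proof (rule Suc.IH)
    show "0 \<le> t (Suc i)" using lt Suc.prems(1) by simp
    show "t (Suc i + j) < t (Suc i + Suc j)" if "j < n" for j using Suc.prems(2)[of "Suc j"] that by simp
    show "B (Suc i + j) \<in> sets borel" if "j \<le> n" for j using Suc.prems(3)[of "Suc j"] that by simp
  qed
  have "trans_kernel p (t i) (t (Suc i)) \<in> borel \<rightarrow>\<^sub>M subprob_algebra borel"
    using trans_kernel_measurable[OF Suc.prems(1) lt] by (rule measurable_prob_algebraD)
  from measurable_compose[OF this nn_integral_measurable_subprob_algebra[OF IH]]
  have [measurable]: "(\<lambda>x. \<integral>\<^sup>+y. cylinder_integral p t B (Suc i) n y \<partial>trans_kernel p (t i) (t (Suc i)) x)
    \<in> borel_measurable borel" .
  show ?case by simp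
qed

text \<open>The induction removes the earliest time: its condition is absorbed into
  \<open>G\<close>, which is why \<open>G\<close> is an arbitrary event of the past. The induction
  hypothesis yields an integral over the state at the next time, and \<open>markov_step\<close>
  moves it back. The process runs at times shifted by \<open>kT\<close>, while the iterated integral
  uses the unshifted times.\<close>

lemma cylinder_markov:
  assumes "0 \<le> t i" and "\<And>j. j < n \<Longrightarrow> t (i + j) < t (i + Suc j)"
    and "\<And>j. j \<le> n \<Longrightarrow> B (i + j) \<in> sets borel"
    and "G \<in> sets (\<F> (real k * T + t i))"
  shows "emeasure (P x) {\<omega> \<in> G. \<forall>j\<le>n. \<xi> (real k * T + t (i + j)) \<omega> \<in> B (i + j)}
    = (\<integral>\<^sup>+\<omega>. cylinder_integral p t B i n (\<xi> (real k * T + t i) \<omega>) * indicator G \<omega> \<partial>P x)"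
  using assms
proof (induction n arbitrary: i G)
  case (0 i G)
  let ?s = "real k * T + t i"
  have s: "0 \<le> ?s" using 0 T_pos by simp
  have [measurable]: "B i \<in> sets borel" using "0.prems"(3)[of 0] by simp
  have [measurable]: "G \<in> sets \<A>" using 0 sets_\<F>_subset by blast
  have [measurable]: "\<xi> ?s \<in> borel_measurable \<A>" using s by simp
  have "{\<omega> \<in> G. \<xi> ?s \<omega> \<in> B i} = {\<omega> \<in> space \<A>. \<omega> \<in> G \<and> \<xi> ?s \<omega> \<in> B i}"
    using sets.sets_into_space[of G \<A>] by auto
  then have "emeasure (P x) {\<omega> \<in> G. \<xi> ?s \<omega> \<in> B i} = (\<integral>\<^sup>+\<omega>. indicator {\<omega> \<in> space \<A>. \<omega> \<in> G \<and> \<xi> ?s \<omega> \<in> B i} \<omega> \<partial>P x)"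
    by simp
  also have "\<dots> = (\<integral>\<^sup>+\<omega>. indicator (B i) (\<xi> ?s \<omega>) * indicator G \<omega> \<partial>P x)"
    by (intro nn_integral_cong) (auto simp: indicator_def)
  finally show ?case by simp
next
  case (Suc n i G)
  let ?s = "real k * T + t i" and ?u = "real k * T + t (Suc i)"
  have lt: "t i < t (Suc i)" using Suc.prems(2)[of 0] by simp
  have s: "0 \<le> ?s" "?s < ?u" using Suc.prems(1) T_pos lt by simp_all
  have [measurable]: "B i \<in> sets borel" using Suc.prems(3)[of 0] by simp
  define G' where "G' = {\<omega> \<in> G. \<xi> ?s \<omega> \<in> B i}"
  have G_sub: "G \<subseteq> space \<A>" using sets.sets_into_space[OF Suc.prems(4)] by simp
  have G'_eq: "G' = G \<inter> (\<xi> ?s -` B i \<inter> space (\<F> ?s))"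
    using G_sub by (auto simp: G'_def)
  have G': "G' \<in> sets (\<F> ?s)"
    unfolding G'_eq using Suc.prems(4) s(1)
    by (intro sets.Int measurable_sets[OF \<F>_measurable]) auto
  have step: "0 \<le> t (Suc i)" "\<And>j. j < n \<Longrightarrow> t (Suc i + j) < t (Suc i + Suc j)"
      "\<And>j. j \<le> n \<Longrightarrow> B (Suc i + j) \<in> sets borel"
    using lt Suc.prems(1) Suc.prems(2)[of "Suc _"] Suc.prems(3)[of "Suc _"] by auto
  have "{\<omega> \<in> G. \<forall>j\<le>Suc n. \<xi> (real k * T + t (i + j)) \<omega> \<in> B (i + j)}
      = {\<omega> \<in> G'. \<forall>j\<le>n. \<xi> (real k * T + t (Suc i + j)) \<omega> \<in> B (Suc i + j)}"
    using All_less_Suc2[of "Suc n"] by (auto simp: G'_def less_Suc_eq_le)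
  also have "emeasure (P x) \<dots>
      = (\<integral>\<^sup>+\<omega>. cylinder_integral p t B (Suc i) n (\<xi> ?u \<omega>) * indicator G' \<omega> \<partial>P x)"
    by (rule Suc.IH[where i="Suc i"]; (rule step)?) (use G' \<F>_mono[of ?s ?u] s in auto)
  also have "\<dots> = (\<integral>\<^sup>+\<omega>. (\<integral>\<^sup>+y. cylinder_integral p t B (Suc i) n y \<partial>trans_kernel p ?s ?u (\<xi> ?s \<omega>))
      * indicator G' \<omega> \<partial>P x)"
    by (rule markov_step[OF s G' cylinder_integral_measurable[of t "Suc i" n B, OF step]])
  also have "\<dots> = (\<integral>\<^sup>+\<omega>. cylinder_integral p t B i (Suc n) (\<xi> ?s \<omega>) * indicator G \<omega> \<partial>P x)"
    using trans_kernel_shift[OF Suc.prems(1) lt]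
    by (intro nn_integral_cong) (auto simp: G'_def indicator_def)
  finally show ?case .
qed

section \<open>The law of the whole trajectory as a Markov kernel\<close>

definition path :: "real \<Rightarrow> 'w \<Rightarrow> real \<Rightarrow> real" where
  "path s \<omega> = (\<lambda>t\<in>{0..}. \<xi> (s + t) \<omega>)"

definition path_law :: "real \<Rightarrow> (real \<Rightarrow> real) measure" where
  "path_law x = distr (P x) (path_space {0..}) (path 0)"

lemma path_in_path_space:
  assumes "0 \<le> s" and "\<omega> \<in> space \<A>"
  shows "path s \<omega> \<in> space (path_space {0..})"
proof -
  have "continuous_on {0..} (\<lambda>t. \<xi> (s + t) \<omega>)"
    by (rule continuous_on_compose2[OF \<xi>_continuous[OF assms(2)]])
       (use assms(1) in \<open>auto intro!: continuous_intros\<close>)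
  then have "continuous_on {0..} (path s \<omega>)"
    by (rule continuous_on_eq) (simp add: path_def)
  then show ?thesis by (simp add: space_path_space path_def)
qed

lemma path_measurable: "0 \<le> s \<Longrightarrow> path s \<in> \<A> \<rightarrow>\<^sub>M path_space {0..}"
  by (rule measurable_path_space) (auto simp: path_in_path_space, simp add: path_def)

lemma path_measurable_PiM: "0 \<le> s \<Longrightarrow> path s \<in> \<A> \<rightarrow>\<^sub>M PiM {0..} (\<lambda>_. borel)"
  by (rule measurable_PiM_single') (auto simp: path_def split: if_splits)

text \<open>The point is that one function \<open>c\<close> serves all \<open>x\<close>,
  \<open>k\<close> and \<open>G\<close>. The case \<open>k = 0\<close> with \<open>G\<close> the
  whole space identifies \<open>c y\<close> as the probability of the cylinder under
  \<open>P y\<close>; other \<open>k\<close> say that the future after \<open>kT\<close> has the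
  same law. Time 0 is added to \<open>J\<close> with the trivial condition
  \<open>UNIV\<close>.\<close>

lemma finite_dimensional_markov:
  assumes "finite J" and "J \<subseteq> {0..}" and "\<And>t. t \<in> J \<Longrightarrow> A t \<in> sets borel"
  obtains c :: "real \<Rightarrow> ennreal" where "c \<in> borel_measurable borel"
    and "\<And>x k G. G \<in> sets (\<F> (real k * T)) \<Longrightarrow>
      emeasure (P x) {\<omega> \<in> G. \<forall>t\<in>J. \<xi> (real k * T + t) \<omega> \<in> A t}
      = (\<integral>\<^sup>+\<omega>. c (\<xi> (real k * T) \<omega>) * indicator G \<omega> \<partial>P x)"
proof -
  define A' where "A' t = (if t \<in> J then A t else UNIV)" for t
  obtain n t where t: "t 0 = 0" "\<And>i. i < n \<Longrightarrow> t i < t (Suc i)" "t ` {..n} = insert 0 J"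
    using finite_set_enumeration[of "insert 0 J"] assms(1,2) by auto
  have A': "A' (t j) \<in> sets borel" for j using assms(3) by (simp add: A'_def)
  show ?thesis
  proof
    show "cylinder_integral p t (\<lambda>j. A' (t j)) 0 n \<in> borel_measurable borel"
      using t A' by (intro cylinder_integral_measurable) auto
    fix x k G assume G: "G \<in> sets (\<F> (real k * T))"
    have "(\<forall>s\<in>J. \<xi> (real k * T + s) \<omega> \<in> A s) \<longleftrightarrow> (\<forall>s\<in>t ` {..n}. \<xi> (real k * T + s) \<omega> \<in> A' s)" for \<omega>
      unfolding t(3) by (auto simp: A'_def)
    then have "{\<omega> \<in> G. \<forall>s\<in>J. \<xi> (real k * T + s) \<omega> \<in> A s}
        = {\<omega> \<in> G. \<forall>j\<le>n. \<xi> (real k * T + t (0 + j)) \<omega> \<in> A' (t (0 + j))}"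
      by auto
    also have "emeasure (P x) \<dots>
        = (\<integral>\<^sup>+\<omega>. cylinder_integral p t (\<lambda>j. A' (t j)) 0 n (\<xi> (real k * T + t 0) \<omega>) * indicator G \<omega> \<partial>P x)"
      using t A' G by (intro cylinder_markov) auto
    finally show "emeasure (P x) {\<omega> \<in> G. \<forall>s\<in>J. \<xi> (real k * T + s) \<omega> \<in> A s}
        = (\<integral>\<^sup>+\<omega>. cylinder_integral p t (\<lambda>j. A' (t j)) 0 n (\<xi> (real k * T) \<omega>) * indicator G \<omega> \<partial>P x)"
      using t(1) by simp
  qed
qed

lemma path_in_prod_emb:
  assumes "J \<subseteq> {0..}"
  shows "path s \<omega> \<in> prod_emb {0..} (\<lambda>_. borel) J (Pi\<^sub>E J A) \<longleftrightarrow> (\<forall>t\<in>J. \<xi> (s + t) \<omega> \<in> A t)"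
  using assms by (auto simp: prod_emb_def path_def PiE_iff extensional_def restrict_def subset_iff)

text \<open>Trajectories are continuous, so an event of the path space may be replaced by a product
  event with the same trace. The arguments can then take place on the product space, where finite
  cylinders determine a finite measure.\<close>

lemma path_space_event:
  assumes "H \<in> sets (path_space {0..})"
  obtains H' where "H' \<in> sets (PiM {0..} (\<lambda>_. borel))"
    and "\<And>s \<omega>. 0 \<le> s \<Longrightarrow> \<omega> \<in> space \<A> \<Longrightarrow> path s \<omega> \<in> H \<longleftrightarrow> path s \<omega> \<in> H'"
proof -
  obtain H' where H': "H' \<in> sets (PiM {0..} (\<lambda>_. borel))" "H = {w. continuous_on {0..} w} \<inter> H'"
    using assms by (auto simp: path_space_def sets_restrict_space)
  have "path s \<omega> \<in> H \<longleftrightarrow> path s \<omega> \<in> H'" if "0 \<le> s" "\<omega> \<in> space \<A>" for s \<omega>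
    using path_in_path_space[OF that] H' by (auto simp: space_path_space)
  with H'(1) that show thesis by blast
qed

lemma nn_integral_start:
  assumes "f \<in> borel_measurable borel"
  shows "(\<integral>\<^sup>+\<omega>. f (\<xi> 0 \<omega>) * indicator (space \<A>) \<omega> \<partial>P x) = f x"
proof -
  interpret prob_space "P x" by (rule prob_space_P)
  have "(\<integral>\<^sup>+\<omega>. f (\<xi> 0 \<omega>) * indicator (space \<A>) \<omega> \<partial>P x) = (\<integral>\<^sup>+\<omega>. f x \<partial>P x)"
  proof (intro nn_integral_cong_AE)
    show "AE \<omega> in P x. f (\<xi> 0 \<omega>) * indicator (space \<A>) \<omega> = f x"
      using \<xi>_start[of x] AE_space
    proof eventually_elim
      case (elim \<omega>)
      then show ?case by simp
    qed
  qed
  then show ?thesis by (simp add: emeasure_space_1[simplified])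
qed

lemma space_in_\<F>: "space \<A> \<in> sets (\<F> s)"
  using sets.top[of "\<F> s"] by simp

text \<open>Measurability in the starting point need only be checked on the cylinders that generate
  the product \<sigma>-field, and there the probability is the measurable function \<open>c\<close>
  of \<open>finite_dimensional_markov\<close>.\<close>

lemma path_law_PiM_measurable:
  "(\<lambda>x. distr (P x) (PiM {0..} (\<lambda>_. borel)) (path 0)) \<in> borel \<rightarrow>\<^sub>M prob_algebra (PiM {0..} (\<lambda>_. borel))"
proof (rule measurable_prob_algebra_generated[OF sets_PiM Int_stable_prod_algebra prod_algebra_sets_into_space])
  fix x
  show "prob_space (distr (P x) (PiM {0..} (\<lambda>_. borel)) (path 0))"
    using path_measurable_PiM[of 0] by (intro prob_space.prob_space_distr[OF prob_space_P]) simp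
next
  fix A :: "(real \<Rightarrow> real) set" assume "A \<in> prod_algebra {0..} (\<lambda>_. borel)"
  then obtain J :: "real set" and E :: "real \<Rightarrow> real set" where A: "A = prod_emb {0..} (\<lambda>_. borel) J (Pi\<^sub>E J E)"
    and J: "finite J" "J \<subseteq> {0..}" "\<And>t. t \<in> J \<Longrightarrow> E t \<in> sets borel"
    by (rule prod_algebraE) blast
  obtain c where c: "c \<in> borel_measurable borel"
    and cP: "\<And>x k G. G \<in> sets (\<F> (real k * T)) \<Longrightarrow>
      emeasure (P x) {\<omega> \<in> G. \<forall>t\<in>J. \<xi> (real k * T + t) \<omega> \<in> E t}
      = (\<integral>\<^sup>+\<omega>. c (\<xi> (real k * T) \<omega>) * indicator G \<omega> \<partial>P x)"
    using finite_dimensional_markov[of J E, OF J] by blast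
  have A_sets: "A \<in> sets (PiM {0..} (\<lambda>_. borel))"
    unfolding A using J by (intro sets_PiM_I) auto
  have "emeasure (distr (P x) (PiM {0..} (\<lambda>_. borel)) (path 0)) A = c x" for x
  proof -
    have "emeasure (distr (P x) (PiM {0..} (\<lambda>_. borel)) (path 0)) A
        = emeasure (P x) (path 0 -` A \<inter> space (P x))"
      using path_measurable_PiM[of 0] A_sets by (intro emeasure_distr) simp_all
    also have "path 0 -` A \<inter> space (P x) = {\<omega> \<in> space \<A>. \<forall>t\<in>J. \<xi> (real 0 * T + t) \<omega> \<in> E t}"
      unfolding A using J(2) by (auto simp: path_in_prod_emb)
    also have "emeasure (P x) \<dots> = c x"
      using cP[OF space_in_\<F>, of x 0] nn_integral_start[OF c, of x] by simp
    finally show ?thesis .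
  qed
  then show "(\<lambda>x. emeasure (distr (P x) (PiM {0..} (\<lambda>_. borel)) (path 0)) A) \<in> borel_measurable borel"
    using c by simp
qed simp

lemma sets_path_law[simp]: "sets (path_law x) = sets (path_space {0..})"
  by (simp add: path_law_def)

lemma space_path_law[simp]: "space (path_law x) = space (path_space {0..})"
  by (simp add: path_law_def)

lemma prob_space_path_law: "prob_space (path_law x)"
  unfolding path_law_def using path_measurable[of 0]
  by (intro prob_space.prob_space_distr[OF prob_space_P]) simp

lemma emeasure_path_law:
  "H \<in> sets (path_space {0..}) \<Longrightarrow> emeasure (path_law x) H = emeasure (P x) {\<omega> \<in> space \<A>. path 0 \<omega> \<in> H}"
  unfolding path_law_def using path_measurable[of 0]
  by (subst emeasure_distr) (auto intro!: arg_cong[where f="emeasure (P x)"])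

lemma emeasure_path_law_PiM:
  assumes "H \<in> sets (path_space {0..})" "H' \<in> sets (PiM {0..} (\<lambda>_. borel))"
    and "\<And>\<omega>. \<omega> \<in> space \<A> \<Longrightarrow> path 0 \<omega> \<in> H \<longleftrightarrow> path 0 \<omega> \<in> H'"
  shows "emeasure (path_law x) H = emeasure (distr (P x) (PiM {0..} (\<lambda>_. borel)) (path 0)) H'"
  using assms path_measurable_PiM[of 0]
  by (subst emeasure_distr) (auto simp: emeasure_path_law intro!: arg_cong[where f="emeasure (P x)"])

lemma path_law_measurable: "path_law \<in> borel \<rightarrow>\<^sub>M prob_algebra (path_space {0..})"
proof (intro measurable_prob_algebraI measurable_subprob_algebra)
  fix H assume H: "H \<in> sets (path_space {0..})"
  then obtain H' where H': "H' \<in> sets (PiM {0..} (\<lambda>_. borel))"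
    "\<And>s \<omega>. 0 \<le> s \<Longrightarrow> \<omega> \<in> space \<A> \<Longrightarrow> path s \<omega> \<in> H \<longleftrightarrow> path s \<omega> \<in> H'"
    using path_space_event by blast
  have "(\<lambda>x. emeasure (distr (P x) (PiM {0..} (\<lambda>_. borel)) (path 0)) H') \<in> borel_measurable borel"
    by (rule measurable_emeasure_kernel[OF measurable_prob_algebraD[OF path_law_PiM_measurable] H'(1)])
  then show "(\<lambda>x. emeasure (path_law x) H) \<in> borel_measurable borel"
    using emeasure_path_law_PiM[OF H H'(1) H'(2)[OF order.refl]] by simp
qed (auto simp: prob_space_path_law intro: prob_space_imp_subprob_space)

text \<open>Both sides, as functions of the event, are measures: the law of the future under
  \<open>P x\<close> restricted to \<open>G\<close>, and a mixture of path laws. They agree on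
  cylinders because both are integrals of the same \<open>c\<close>, so they agree on all
  events.\<close>

lemma path_markov:
  assumes G: "G \<in> sets (\<F> (real k * T))" and H: "H \<in> sets (path_space {0..})"
  shows "emeasure (P x) {\<omega> \<in> G. path (real k * T) \<omega> \<in> H}
    = (\<integral>\<^sup>+\<omega>. emeasure (path_law (\<xi> (real k * T) \<omega>)) H * indicator G \<omega> \<partial>P x)"
proof -
  let ?s = "real k * T" and ?PiM = "PiM {0..} (\<lambda>_. borel :: real measure)"
  interpret P: prob_space "P x" by (rule prob_space_P)
  have s: "0 \<le> ?s" using T_pos by simp
  have [measurable]: "G \<in> sets \<A>" using G sets_\<F>_subset by blast
  have [measurable]: "\<xi> ?s \<in> borel_measurable \<A>" using s by simp
  have G_sub: "G \<subseteq> space \<A>" using sets.sets_into_space[OF G] by simp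
  let ?D = "density (P x) (indicator G)"
  let ?L = "\<lambda>y. distr (P y) ?PiM (path 0)"
  let ?N = "\<lambda>\<omega>. ?L (\<xi> ?s \<omega>)"
  have N[measurable]: "?N \<in> \<A> \<rightarrow>\<^sub>M subprob_algebra ?PiM"
    by (rule measurable_compose[OF _ measurable_prob_algebraD[OF path_law_PiM_measurable]]) measurable
  have ne: "space \<A> \<noteq> {}" using P.not_empty by simp
  have path_s[measurable]: "path ?s \<in> \<A> \<rightarrow>\<^sub>M ?PiM" by (rule path_measurable_PiM[OF s])
  have left: "emeasure (distr ?D ?PiM (path ?s)) A = emeasure (P x) {\<omega> \<in> G. path ?s \<omega> \<in> A}"
    if [measurable]: "A \<in> sets ?PiM" for A
  proof -
    have "emeasure (distr ?D ?PiM (path ?s)) A = emeasure (P x) (G \<inter> (path ?s -` A \<inter> space \<A>))"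
      by (subst emeasure_distr) (auto intro!: emeasure_restricted)
    also have "G \<inter> (path ?s -` A \<inter> space \<A>) = {\<omega> \<in> G. path ?s \<omega> \<in> A}" using G_sub by auto
    finally show ?thesis .
  qed
  have right: "emeasure (?D \<bind> ?N) A = (\<integral>\<^sup>+\<omega>. emeasure (?N \<omega>) A * indicator G \<omega> \<partial>P x)"
    if A: "A \<in> sets ?PiM" for A
  proof -
    have [measurable]: "(\<lambda>\<omega>. emeasure (?N \<omega>) A) \<in> borel_measurable \<A>"
      by (rule measurable_emeasure_kernel[OF N A])
    have "emeasure (?D \<bind> ?N) A = (\<integral>\<^sup>+\<omega>. emeasure (?N \<omega>) A \<partial>?D)"
      using ne A by (intro emeasure_bind[where N="?PiM"]) auto
    also have "\<dots> = (\<integral>\<^sup>+\<omega>. indicator G \<omega> * emeasure (?N \<omega>) A \<partial>P x)"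
      by (intro nn_integral_density) auto
    finally show ?thesis by (simp only: mult.commute)
  qed
  have "distr ?D ?PiM (path ?s) = ?D \<bind> ?N"
  proof (rule measure_eqI_PiM_infinite)
    show "sets (?D \<bind> ?N) = sets ?PiM" using ne by (intro sets_bind) auto
    have "finite_measure ?D"
      by (rule finite_measureI) (simp add: emeasure_restricted P.emeasure_eq_measure)
    then show "finite_measure (distr ?D ?PiM (path ?s))"
      by (intro finite_measure.finite_measure_distr) auto
    fix A :: "real \<Rightarrow> real set" and J :: "real set"
    assume J: "finite J" "J \<subseteq> {0..}" "\<And>i. i \<in> J \<Longrightarrow> A i \<in> sets borel"
    let ?E = "prod_emb {0..} (\<lambda>_. borel) J (Pi\<^sub>E J A)"
    have E: "?E \<in> sets ?PiM" using J by (intro sets_PiM_I) auto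
    obtain c where c: "c \<in> borel_measurable borel"
      and cP: "\<And>x k G. G \<in> sets (\<F> (real k * T)) \<Longrightarrow>
        emeasure (P x) {\<omega> \<in> G. \<forall>t\<in>J. \<xi> (real k * T + t) \<omega> \<in> A t}
        = (\<integral>\<^sup>+\<omega>. c (\<xi> (real k * T) \<omega>) * indicator G \<omega> \<partial>P x)"
      using finite_dimensional_markov[of J A, OF J] by blast
    have L: "emeasure (?L y) ?E = c y" for y
    proof -
      have "emeasure (?L y) ?E = emeasure (P y) {\<omega> \<in> space \<A>. \<forall>t\<in>J. \<xi> (real 0 * T + t) \<omega> \<in> A t}"
        using path_measurable_PiM[of 0] E J(2)
        by (subst emeasure_distr) (auto simp: path_in_prod_emb intro!: arg_cong[where f="emeasure (P y)"])
      also have "\<dots> = c y"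
        using cP[OF space_in_\<F>, of y 0] nn_integral_start[OF c, of y] by simp
      finally show ?thesis .
    qed
    show "emeasure (distr ?D ?PiM (path ?s)) ?E = emeasure (?D \<bind> ?N) ?E"
      unfolding left[OF E] right[OF E] L using cP[OF G] J(2) by (simp add: path_in_prod_emb)
  qed simp
  moreover obtain H' where H': "H' \<in> sets ?PiM"
    "\<And>s \<omega>. 0 \<le> s \<Longrightarrow> \<omega> \<in> space \<A> \<Longrightarrow> path s \<omega> \<in> H \<longleftrightarrow> path s \<omega> \<in> H'"
    using path_space_event[OF H] by blast
  moreover have "{\<omega> \<in> G. path ?s \<omega> \<in> H} = {\<omega> \<in> G. path ?s \<omega> \<in> H'}"
    using H'(2)[OF s] G_sub by auto
  ultimately show ?thesis
    using left[OF H'(1)] right[OF H'(1)] emeasure_path_law_PiM[OF H H'(1) H'(2)[OF order.refl]] by simp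
qed

text \<open>Connects the path laws with the kernel \<open>trans_kernel p 0 T\<close> for which the
  Harris hypothesis is formulated.\<close>

lemma distr_\<xi>_T: "distr (P x) borel (\<xi> T) = trans_kernel p 0 T x"
proof (rule measure_eqI)
  fix B assume "B \<in> sets (distr (P x) borel (\<xi> T))"
  then have B[measurable]: "B \<in> sets borel" by simp
  have T[measurable]: "\<xi> T \<in> borel_measurable \<A>" using T_pos by simp
  have K: "(\<lambda>y. emeasure (trans_kernel p 0 T y) B) \<in> borel_measurable borel"
    using T_pos by (intro measurable_emeasure_kernel[OF measurable_prob_algebraD[OF trans_kernel_measurable] B]) auto
  have "emeasure (distr (P x) borel (\<xi> T)) B = (\<integral>\<^sup>+\<omega>. indicator B (\<xi> T \<omega>) * indicator (space \<A>) \<omega> \<partial>P x)"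
    by (subst emeasure_distr)
       (auto simp: nn_integral_indicator[symmetric] indicator_def simp del: nn_integral_indicator intro!: nn_integral_cong)
  also have "\<dots> = (\<integral>\<^sup>+\<omega>. emeasure (trans_kernel p 0 T (\<xi> 0 \<omega>)) B * indicator (space \<A>) \<omega> \<partial>P x)"
    using T_pos space_in_\<F>[of 0] by (subst markov_step[where s=0]) auto
  also have "\<dots> = emeasure (trans_kernel p 0 T x) B"
    by (rule nn_integral_start[OF K])
  finally show "emeasure (distr (P x) borel (\<xi> T)) B = emeasure (trans_kernel p 0 T x) B" .
qed simp

section \<open>The shift by one period, and segments as restrictions of paths\<close>

definition shift :: "(real \<Rightarrow> real) \<Rightarrow> real \<Rightarrow> real" where
  "shift w = (\<lambda>t\<in>{0..}. w (T + t))"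

lemma shift_measurable: "shift \<in> path_space {0..} \<rightarrow>\<^sub>M path_space {0..}"
proof (rule measurable_path_space)
  fix w assume "w \<in> space (path_space {0..})"
  then have w: "continuous_on {0..} w" by (simp add: space_path_space)
  have "continuous_on {0..} (\<lambda>t. w (T + t))"
    by (rule continuous_on_compose2[OF w]) (use T_pos in \<open>auto intro!: continuous_intros\<close>)
  then have "continuous_on {0..} (shift w)"
    by (rule continuous_on_eq) (simp add: shift_def)
  then show "shift w \<in> space (path_space {0..})" by (simp add: space_path_space shift_def)
next
  fix s :: real assume "s \<in> {0..}"
  then show "(\<lambda>w. shift w s) \<in> borel_measurable (path_space {0..})"
    using T_pos by (simp add: shift_def measurable_path_space_component)
qed

lemma shift_path: "0 \<le> s \<Longrightarrow> shift (path s \<omega>) = path (s + T) \<omega>"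
  using T_pos by (intro ext) (simp add: shift_def path_def add.assoc)

lemma funpow_shift_path: "(shift ^^ k) (path 0 \<omega>) = path (real k * T) \<omega>"
proof (induction k)
  case (Suc k)
  have "0 \<le> real k * T" using T_pos by simp
  then show ?case by (simp add: Suc shift_path distrib_right add.commute)
qed simp

lemma restrict_measurable: "(\<lambda>w. restrict w {0..T}) \<in> path_space {0..} \<rightarrow>\<^sub>M C_space T"
proof -
  have "(\<lambda>w. restrict w {0..T}) \<in> path_space {0..} \<rightarrow>\<^sub>M path_space {0..T}"
  proof (rule measurable_path_space)
    fix w assume "w \<in> space (path_space {0..})"
    then have "continuous_on {0..T} w"
      by (auto simp: space_path_space intro: continuous_on_subset)
    then have "continuous_on {0..T} (restrict w {0..T})"
      by (rule continuous_on_eq) simp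
    then show "restrict w {0..T} \<in> space (path_space {0..T})" by (simp add: space_path_space)
  qed (simp add: measurable_path_space_component)
  then show ?thesis using sets_C_space[OF T_pos] by (simp cong: measurable_cong_sets)
qed

lemma C_space_component_measurable: "s \<in> {0..T} \<Longrightarrow> (\<lambda>\<alpha>. \<alpha> s) \<in> borel_measurable (C_space T)"
  using measurable_path_space_component[of s "{0..T}"] sets_C_space[OF T_pos] by (simp cong: measurable_cong_sets)

lemma segment_eq_restrict: "segment T \<xi> (Suc k) \<omega> = restrict (path (real k * T) \<omega>) {0..T}"
  by (intro ext) (simp add: segment_def path_def)

lemma segment_in_C_space: "\<omega> \<in> space \<A> \<Longrightarrow> segment T \<xi> (Suc k) \<omega> \<in> space (C_space T)"
  unfolding segment_eq_restrict using T_pos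
  by (intro measurable_space[OF restrict_measurable] path_in_path_space) auto

text \<open>Segments are numbered from 1: number \<open>Suc j\<close> covers the times from
  \<open>jT\<close> to \<open>(j+1)T\<close> and is therefore known at time \<open>kT\<close> once
  \<open>Suc j \<le> k\<close>.\<close>

lemma segment_measurable_\<F>:
  assumes "Suc j \<le> k"
  shows "segment T \<xi> (Suc j) \<in> \<F> (real k * T) \<rightarrow>\<^sub>M C_space T"
proof -
  have "segment T \<xi> (Suc j) \<in> \<F> (real k * T) \<rightarrow>\<^sub>M path_space {0..T}"
  proof (rule measurable_path_space)
    fix \<omega> assume "\<omega> \<in> space (\<F> (real k * T))"
    then show "segment T \<xi> (Suc j) \<omega> \<in> space (path_space {0..T})"
      using segment_in_C_space[of \<omega> j] by (simp add: space_C_space space_path_space)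
  next
    fix s assume s: "s \<in> {0..T}"
    have "real j * T + s \<le> real (Suc j) * T" using s by (simp add: algebra_simps)
    also have "\<dots> \<le> real k * T" using assms T_pos by (intro mult_right_mono) auto
    finally have "\<xi> (real j * T + s) \<in> borel_measurable (\<F> (real k * T))"
      using s T_pos by (intro \<F>_measurable) auto
    then show "(\<lambda>\<omega>. segment T \<xi> (Suc j) \<omega> s) \<in> borel_measurable (\<F> (real k * T))"
      using s by (simp add: segment_def)
  qed
  then show ?thesis using sets_C_space[OF T_pos] by (simp cong: measurable_cong_sets)
qed

lemma segment_measurable: "segment T \<xi> (Suc k) \<in> \<A> \<rightarrow>\<^sub>M C_space T"
  using segment_measurable_\<F>[of k "Suc k"] sets_\<F>_subset
  by (auto simp: measurable_def)

section \<open>The chain of segments\<close>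

abbreviation first_segment :: "(real \<Rightarrow> real) \<Rightarrow> real \<Rightarrow> real" where
  "first_segment w \<equiv> restrict w {0..T}"

lemma path_law_subprob: "path_law \<in> borel \<rightarrow>\<^sub>M subprob_algebra (path_space {0..})"
  by (rule measurable_prob_algebraD[OF path_law_measurable])

lemma segment_kernel_eq:
  "segment_kernel T P \<xi> \<alpha> = distr (path_law (\<alpha> T)) (C_space T) first_segment"
proof -
  have "first_segment \<circ> path 0 = segment T \<xi> (Suc 0)"
    using segment_eq_restrict[of 0] by (simp add: fun_eq_iff)
  then show ?thesis
    unfolding segment_kernel_def path_law_def
    using path_measurable[of 0] by (subst distr_distr[OF restrict_measurable]) simp_all
qed

lemma T_component_measurable[measurable]: "(\<lambda>\<alpha>. \<alpha> T) \<in> borel_measurable (C_space T)"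
  using T_pos by (intro C_space_component_measurable) simp

lemma segment_kernel_measurable: "segment_kernel T P \<xi> \<in> C_space T \<rightarrow>\<^sub>M prob_algebra (C_space T)"
  unfolding segment_kernel_eq
  by (rule measurable_compose[OF measurable_compose[OF T_component_measurable path_law_measurable]
        measurable_distr_prob_space[OF restrict_measurable]])

lemma emeasure_segment_kernel:
  assumes "B \<in> sets (C_space T)"
  shows "emeasure (segment_kernel T P \<xi> \<alpha>) B
    = emeasure (path_law (\<alpha> T)) {w \<in> space (path_space {0..}). first_segment w \<in> B}"
  unfolding segment_kernel_eq using assms restrict_measurable
  by (subst emeasure_distr) (auto intro!: arg_cong[where f="emeasure (path_law (\<alpha> T))"] cong: measurable_cong_sets)

text \<open>A step of the segment chain forgets everything but the endpoint, so invariance of a law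
  on \<open>C_space T\<close> becomes a question about its endpoint law on the real line.\<close>

lemma bind_segment_kernel:
  assumes "sets \<nu> = sets (C_space T)" and "space \<nu> \<noteq> {}"
  shows "\<nu> \<bind> segment_kernel T P \<xi>
    = distr (distr \<nu> borel (\<lambda>\<alpha>. \<alpha> T) \<bind> path_law) (C_space T) first_segment"
proof -
  have e: "(\<lambda>\<alpha>. \<alpha> T) \<in> borel_measurable \<nu>"
    using T_component_measurable assms(1) by (simp cong: measurable_cong_sets)
  have "distr \<nu> borel (\<lambda>\<alpha>. \<alpha> T) \<bind> path_law = \<nu> \<bind> (\<lambda>\<alpha>. path_law (\<alpha> T))"
    by (rule bind_distr[OF e path_law_subprob assms(2)])
  then show ?thesis
    unfolding segment_kernel_eq
    using distr_bind[OF measurable_compose[OF e path_law_subprob] assms(2) restrict_measurable] by simp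
qed

lemma component_measurable[measurable]: "0 \<le> s \<Longrightarrow> (\<lambda>w. w s) \<in> borel_measurable (path_space {0..})"
  by (rule measurable_path_space_component) simp

lemma distr_bind_path_law_T:
  assumes "sets \<nu> = sets borel" and "space \<nu> \<noteq> {}"
  shows "distr (\<nu> \<bind> path_law) borel (\<lambda>w. w T) = \<nu> \<bind> trans_kernel p 0 T"
proof -
  have "distr (path_law x) borel (\<lambda>w. w T) = trans_kernel p 0 T x" for x
  proof -
    have "(\<lambda>w. w T) \<circ> path 0 = \<xi> T" using T_pos by (auto simp: path_def fun_eq_iff)
    then show ?thesis
      unfolding path_law_def distr_\<xi>_T[symmetric]
      using path_measurable[of 0] T_pos by (subst distr_distr[OF component_measurable]) simp_all
  qed
  moreover have "path_law \<in> \<nu> \<rightarrow>\<^sub>M subprob_algebra (path_space {0..})"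
    using path_law_subprob assms(1) by (simp cong: measurable_cong_sets)
  ultimately show ?thesis
    using distr_bind[OF _ assms(2) component_measurable] T_pos by simp
qed

lemma distr_bind_path_law_segment_T:
  assumes "sets \<nu> = sets borel" and "space \<nu> \<noteq> {}"
  shows "distr (distr (\<nu> \<bind> path_law) (C_space T) first_segment) borel (\<lambda>\<alpha>. \<alpha> T)
    = distr (\<nu> \<bind> path_law) borel (\<lambda>w. w T)"
proof -
  have "sets (\<nu> \<bind> path_law) = sets (path_space {0..})"
    using assms(2) by (intro sets_bind) auto
  then have "first_segment \<in> (\<nu> \<bind> path_law) \<rightarrow>\<^sub>M C_space T"
    using restrict_measurable by (simp cong: measurable_cong_sets)
  then show ?thesis
    using T_pos by (subst distr_distr[OF T_component_measurable]) (simp_all add: comp_def)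
qed

text \<open>The past of the chain up to \<open>k\<close> lies in the past of \<xi> up to
  \<open>kT\<close>, and \<open>path_markov\<close> holds for the larger \<sigma>-field. The
  conditional probability found is a function of the last segment, hence measurable for the smaller
  one, which characterises it as the conditional expectation there.\<close>

lemma markov_chain_segments:
  "markov_chain (C_space T) (segment_kernel T P \<xi>) (\<lambda>\<alpha>. P (\<alpha> T)) (segment_chain T \<xi>)"
  unfolding markov_chain_def
proof (intro conjI ballI allI)
  show "segment_kernel T P \<xi> \<in> C_space T \<rightarrow>\<^sub>M prob_algebra (C_space T)"
    by (rule segment_kernel_measurable)
next
  fix \<alpha> assume \<alpha>: "\<alpha> \<in> space (C_space T)"
  let ?P = "P (\<alpha> T)" and ?Z = "segment_chain T \<xi> \<alpha>" and ?K = "segment_kernel T P \<xi>"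
  show "prob_space ?P" by (rule prob_space_P)
  interpret P: prob_space ?P by (rule prob_space_P)
  show "AE \<omega> in ?P. ?Z 0 \<omega> = \<alpha>" by (simp add: segment_chain_def)
  have Z\<F>: "?Z j \<in> \<F> (real k * T) \<rightarrow>\<^sub>M C_space T" if "j \<le> k" for j k
  proof (cases j)
    case 0
    then show ?thesis using \<alpha> by (simp add: segment_chain_def[abs_def])
  next
    case (Suc i)
    then show ?thesis using segment_measurable_\<F>[of i k] that by (simp add: segment_chain_def[abs_def])
  qed
  show Z: "?Z k \<in> ?P \<rightarrow>\<^sub>M C_space T" for k
    using Z\<F>[of k k] sets_\<F>_subset by (auto simp: measurable_def)
  \<comment> \<open>Exact for \<open>k > 0\<close>; for \<open>k = 0\<close> the prescribed segment
    \<alpha> need not belong to the trajectory, and only its endpoint is matched, almost surely, by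
    the starting value of \<xi>.\<close>
  have Z_T: "AE \<omega> in ?P. ?Z k \<omega> T = \<xi> (real k * T) \<omega>" for k
  proof (cases k)
    case 0
    then show ?thesis using \<xi>_start[of "\<alpha> T"] by (auto simp: segment_chain_def elim!: eventually_mono)
  next
    case (Suc i)
    then show ?thesis using T_pos by (simp add: segment_chain_def segment_def algebra_simps)
  qed
  fix k B assume B: "B \<in> sets (C_space T)"
  let ?G = "generated_algebra (space ?P) (C_space T) {..k} ?Z"
  have sub: "sets ?G \<subseteq> sets (\<F> (real k * T))"
    by (rule sets_generated_algebra_subset) (auto intro: Z\<F>)
  have "finite_measure_subalgebra ?P ?G"
    by unfold_locales (use sub sets_\<F>_subset in \<open>auto simp: subalgebra_def\<close>)
  then interpret F: sigma_finite_subalgebra ?P ?G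
    by (rule finite_measure_subalgebra_is_sigma_finite)
  have K_meas: "(\<lambda>\<alpha>. measure (?K \<alpha>) B) \<in> borel_measurable (C_space T)"
    using measurable_compose[OF measurable_prob_algebraD[OF segment_kernel_measurable] measurable_measure_subprob_algebra[OF B]] .
  have K_prob: "prob_space (?K \<alpha>)" for \<alpha>
    unfolding segment_kernel_eq using restrict_measurable
    by (intro prob_space.prob_space_distr[OF prob_space_path_law]) (simp cong: measurable_cong_sets)
  have K_real: "emeasure (?K \<alpha>) B = ennreal (measure (?K \<alpha>) B)" for \<alpha>
    using K_prob[of \<alpha>] by (simp add: finite_measure.emeasure_eq_measure prob_space_def)
  have K_le: "measure (?K \<alpha>) B \<le> 1" for \<alpha>
    using K_prob by (rule prob_space.prob_le_1)
  have gG: "(\<lambda>\<omega>. measure (?K (?Z k \<omega>)) B) \<in> borel_measurable ?G"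
    using measurable_space[OF Z]
    by (intro measurable_compose[OF measurable_generated_algebra K_meas]) auto
  note [measurable] = K_meas Z B
  have int_f: "integrable ?P (\<lambda>\<omega>. indicat_real B (?Z (Suc k) \<omega>))"
    by (rule P.integrable_const_bound[where B=1]) (auto simp: indicator_def)
  have int_g: "integrable ?P (\<lambda>\<omega>. measure (?K (?Z k \<omega>)) B)"
    by (rule P.integrable_const_bound[where B=1]) (auto simp: K_le intro: measurable_compose[OF Z K_meas])
  show "AE \<omega> in ?P. real_cond_exp ?P ?G (\<lambda>\<omega>. indicator B (?Z (Suc k) \<omega>)) \<omega> = measure (?K (?Z k \<omega>)) B"
  proof (rule F.real_cond_exp_charact[OF _ int_f int_g gG])
    fix G assume "G \<in> sets ?G"
    then have G: "G \<in> sets (\<F> (real k * T))" using sub by blast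
    then have GA[measurable]: "G \<in> sets \<A>" using sets_\<F>_subset by blast
    have G_sub: "G \<subseteq> space \<A>" using sets.sets_into_space[OF GA] .
    let ?H = "{w \<in> space (path_space {0..}). first_segment w \<in> B}"
    have H: "?H \<in> sets (path_space {0..})"
      using restrict_measurable by measurable
    have int_f': "integrable ?P (\<lambda>\<omega>. indicat_real G \<omega> * indicat_real B (?Z (Suc k) \<omega>))"
      by (rule P.integrable_const_bound[where B=1]) (auto simp: indicator_def)
    have int_g': "integrable ?P (\<lambda>\<omega>. indicat_real G \<omega> * measure (?K (?Z k \<omega>)) B)"
      by (rule P.integrable_const_bound[where B=1])
         (auto simp: indicator_def K_le intro: measurable_compose[OF Z K_meas])
    have GH: "{\<omega> \<in> G. path (real k * T) \<omega> \<in> ?H} = {\<omega> \<in> G. ?Z (Suc k) \<omega> \<in> B}"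
      using G_sub path_in_path_space[of "real k * T"] T_pos
      by (auto simp: segment_chain_def segment_eq_restrict)
    have GH_eq: "{\<omega> \<in> G. ?Z (Suc k) \<omega> \<in> B} = {\<omega> \<in> space \<A>. \<omega> \<in> G \<and> ?Z (Suc k) \<omega> \<in> B}"
      using G_sub by auto
    have "ennreal (\<integral>\<omega>. indicat_real G \<omega> * indicat_real B (?Z (Suc k) \<omega>) \<partial>?P)
        = (\<integral>\<^sup>+\<omega>. ennreal (indicat_real G \<omega> * indicat_real B (?Z (Suc k) \<omega>)) \<partial>?P)"
      by (rule nn_integral_eq_integral[OF int_f', symmetric]) simp
    also have "\<dots> = (\<integral>\<^sup>+\<omega>. indicator {\<omega> \<in> space \<A>. \<omega> \<in> G \<and> ?Z (Suc k) \<omega> \<in> B} \<omega> \<partial>?P)"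
      by (intro nn_integral_cong) (auto simp: indicator_def)
    also have "\<dots> = emeasure ?P {\<omega> \<in> G. path (real k * T) \<omega> \<in> ?H}"
      unfolding GH GH_eq by (rule nn_integral_indicator) measurable
    also have "\<dots> = (\<integral>\<^sup>+\<omega>. emeasure (path_law (\<xi> (real k * T) \<omega>)) ?H * indicator G \<omega> \<partial>?P)"
      by (rule path_markov[OF G H])
    also have "\<dots> = (\<integral>\<^sup>+\<omega>. ennreal (indicat_real G \<omega> * measure (?K (?Z k \<omega>)) B) \<partial>?P)"
    proof (rule nn_integral_cong_AE)
      show "AE \<omega> in ?P. emeasure (path_law (\<xi> (real k * T) \<omega>)) ?H * indicator G \<omega>
          = ennreal (indicat_real G \<omega> * measure (?K (?Z k \<omega>)) B)"
        using Z_T[of k]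
      proof eventually_elim
        case (elim \<omega>)
        then have "emeasure (path_law (\<xi> (real k * T) \<omega>)) ?H = ennreal (measure (?K (?Z k \<omega>)) B)"
          by (simp add: emeasure_segment_kernel[OF B] flip: K_real)
        then show ?case by (simp add: indicator_def)
      qed
    qed
    also have "\<dots> = ennreal (\<integral>\<omega>. indicat_real G \<omega> * measure (?K (?Z k \<omega>)) B \<partial>?P)"
      by (rule nn_integral_eq_integral[OF int_g']) simp
    finally show "(\<integral>\<omega>\<in>G. indicator B (?Z (Suc k) \<omega>) \<partial>?P) = (\<integral>\<omega>\<in>G. measure (?K (?Z k \<omega>)) B \<partial>?P)"
      by (simp add: set_lebesgue_integral_def integral_nonneg)
  qed
qed

section \<open>Existence and uniqueness of the segment law\<close>

lemma segment_law_bind_path_law: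
  assumes "prob_space \<nu>" and \<nu>: "sets \<nu> = sets borel"
  shows "segment_law T p \<nu> (distr (\<nu> \<bind> path_law) (C_space T) first_segment)"
proof -
  interpret \<nu>: prob_space \<nu> by fact
  let ?N = "\<nu> \<bind> path_law"
  have L: "path_law \<in> \<nu> \<rightarrow>\<^sub>M subprob_algebra (path_space {0..})"
    using path_law_subprob \<nu> by (simp cong: measurable_cong_sets)
  have sets_N: "sets ?N = sets (path_space {0..})"
    using \<nu>.not_empty by (intro sets_bind) auto
  have X: "first_segment \<in> ?N \<rightarrow>\<^sub>M C_space T"
    using restrict_measurable sets_N by (simp cong: measurable_cong_sets)
  have "prob_space ?N"
    by (rule \<nu>.prob_space_bind[OF _ L]) (simp add: prob_space_path_law)
  then have prob: "prob_space (distr ?N (C_space T) first_segment)"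
    by (rule prob_space.prob_space_distr) (rule X)
  have cyl: "emeasure (distr ?N (C_space T) first_segment) {\<alpha> \<in> space (C_space T). \<forall>i\<le>l + 1. \<alpha> (t i) \<in> B i}
      = (\<integral>\<^sup>+ x. cylinder_integral p t B 0 (l + 1) x \<partial>\<nu>)"
    if t0: "t 0 = 0" and tT: "t (l + 1) = T" and t: "\<forall>i\<le>l. t i < t (i + 1)"
      and B: "\<forall>i\<le>l + 1. B i \<in> sets borel" for l :: nat and t B
  proof -
    have mono: "t i \<le> t j" if "i \<le> j" "j \<le> l + 1" for i j
      using that
    proof (induction j rule: dec_induct)
      case (step j)
      then have "t j < t (j + 1)" using t by auto
      with step show ?case by simp
    qed simp
    have tI: "t i \<in> {0..T}" if "i \<le> l + 1" for i
      using mono[of 0 i] mono[of i "l + 1"] that t0 tT by simp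
    let ?C = "{\<alpha> \<in> space (C_space T). \<forall>i\<le>l + 1. \<alpha> (t i) \<in> B i}"
    let ?H = "{w \<in> space (path_space {0..}). \<forall>i\<le>l + 1. w (t i) \<in> B i}"
    have "?C = (\<Inter>i\<in>{..l + 1}. (\<lambda>\<alpha>. \<alpha> (t i)) -` B i \<inter> space (C_space T))" by auto
    also have "\<dots> \<in> sets (C_space T)"
      using tI B by (intro sets.finite_INT measurable_sets[OF C_space_component_measurable]) auto
    finally have C: "?C \<in> sets (C_space T)" .
    have "?H = (\<Inter>i\<in>{..l + 1}. (\<lambda>w. w (t i)) -` B i \<inter> space (path_space {0..}))" by auto
    also have "\<dots> \<in> sets (path_space {0..})"
      using tI B by (intro sets.finite_INT measurable_sets[OF component_measurable]) auto
    finally have H: "?H \<in> sets (path_space {0..})" .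
    have "emeasure (distr ?N (C_space T) first_segment) ?C = emeasure ?N (first_segment -` ?C \<inter> space ?N)"
      by (rule emeasure_distr[OF X C])
    also have "first_segment -` ?C \<inter> space ?N = ?H"
      using measurable_space[OF restrict_measurable] tI sets_eq_imp_space_eq[OF sets_N] by fastforce
    also have "emeasure ?N ?H = (\<integral>\<^sup>+x. emeasure (path_law x) ?H \<partial>\<nu>)"
      by (rule emeasure_bind[OF \<nu>.not_empty L H])
    also have "\<dots> = (\<integral>\<^sup>+ x. cylinder_integral p t B 0 (l + 1) x \<partial>\<nu>)"
    proof (rule nn_integral_cong)
      fix x
      have "emeasure (path_law x) ?H
          = emeasure (P x) {\<omega> \<in> space \<A>. \<forall>j\<le>l + 1. \<xi> (real 0 * T + t (0 + j)) \<omega> \<in> B (0 + j)}"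
        unfolding emeasure_path_law[OF H]
        using tI path_in_path_space[of 0]
        by (intro arg_cong[where f="emeasure (P x)"]) (auto simp: path_def)
      also have "\<dots> = (\<integral>\<^sup>+\<omega>. cylinder_integral p t B 0 (l + 1) (\<xi> (real 0 * T + t 0) \<omega>) * indicator (space \<A>) \<omega> \<partial>P x)"
        using t t0 B space_in_\<F>[of 0] by (intro cylinder_markov) auto
      also have "\<dots> = cylinder_integral p t B 0 (l + 1) x"
        using nn_integral_start[OF cylinder_integral_measurable[of t 0 "l + 1" B], of x] t t0 B by simp
      finally show "emeasure (path_law x) ?H = cylinder_integral p t B 0 (l + 1) x" .
    qed
    finally show ?thesis .
  qed
  show ?thesis
    unfolding segment_law_def
  proof (intro conjI allI impI)
    show "prob_space (distr ?N (C_space T) first_segment)" by (rule prob)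
    show "sets (distr ?N (C_space T) first_segment) = sets (C_space T)" by (rule sets_distr)
    fix l :: nat and t :: "nat \<Rightarrow> real" and B :: "nat \<Rightarrow> real set"
    assume tB: "t 0 = 0" "t (l + 1) = T" "\<forall>i\<le>l. t i < t (i + 1)" "\<forall>i\<le>l + 1. B i \<in> sets borel"
    show "emeasure (distr ?N (C_space T) first_segment)
        {\<alpha> \<in> space (distr ?N (C_space T) first_segment). \<forall>i\<le>l + 1. \<alpha> (t i) \<in> B i}
        = (\<integral>\<^sup>+ x. cylinder_integral p t B 0 (l + 1) x \<partial>\<nu>)"
      unfolding space_distr by (rule cyl[OF tB])
  qed
qed

lemma segment_lawD:
  assumes "segment_law T p \<nu> m" and "t 0 = 0" and "t (l + 1) = T" and "\<forall>i\<le>l. t i < t (i + 1)"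
    and "\<forall>i\<le>l + 1. B i \<in> sets borel"
  shows "emeasure m {\<alpha> \<in> space m. \<forall>i\<le>l + 1. \<alpha> (t i) \<in> B i}
    = (\<integral>\<^sup>+ x. cylinder_integral p t B 0 (l + 1) x \<partial>\<nu>)"
  using assms(1)[unfolded segment_law_def, THEN conjunct2, THEN conjunct2, THEN spec[of _ l],
      THEN spec[of _ t], THEN spec[of _ B], THEN mp, THEN mp, THEN mp, THEN mp, OF assms(2-5)] .

text \<open>The defining formula prescribes cylinders over partitions from 0 to \<open>T\<close>. An
  arbitrary finite set \<open>J\<close> of times is completed by 0 and \<open>T\<close> with the
  condition \<open>UNIV\<close> at times outside \<open>J\<close>, so the formula fixes all
  finite-dimensional laws.\<close>

lemma segment_law_eqI:
  assumes m: "segment_law T p \<nu> m" and m': "segment_law T p \<nu> m'"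
  shows "m = m'"
proof -
  let ?I = "{0..T}"
  let ?PiM = "PiM ?I (\<lambda>_. borel :: real measure)"
  have sets: "sets m = sets (path_space ?I)" "sets m' = sets (path_space ?I)"
    using m m' sets_C_space[OF T_pos] by (simp_all add: segment_law_def)
  have space: "space m = space (path_space ?I)" "space m' = space (path_space ?I)"
    by (rule sets_eq_imp_space_eq, rule sets)+
  have id: "(\<lambda>w. w) \<in> path_space ?I \<rightarrow>\<^sub>M ?PiM"
    unfolding path_space_def by (rule measurable_restrict_space1) simp
  have idm: "(\<lambda>w. w) \<in> m \<rightarrow>\<^sub>M ?PiM" "(\<lambda>w. w) \<in> m' \<rightarrow>\<^sub>M ?PiM"
    using id sets by (simp_all cong: measurable_cong_sets)
  have eq: "distr m ?PiM (\<lambda>w. w) = distr m' ?PiM (\<lambda>w. w)"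
  proof (rule measure_eqI_PiM_infinite)
    show "finite_measure (distr m ?PiM (\<lambda>w. w))"
      using m idm by (intro finite_measure.finite_measure_distr) (auto simp: segment_law_def prob_space_def)
    fix A :: "real \<Rightarrow> real set" and J :: "real set"
    assume J: "finite J" "J \<subseteq> ?I" "\<And>i. i \<in> J \<Longrightarrow> A i \<in> sets borel"
    let ?E = "prod_emb ?I (\<lambda>_. borel) J (Pi\<^sub>E J A)"
    have E: "?E \<in> sets ?PiM" using J by (intro sets_PiM_I) auto
    have "\<exists>n t. t 0 = 0 \<and> (\<forall>i<n. t i < t (Suc i)) \<and> t ` {..n} = insert 0 (insert T J)"
      by (rule finite_set_enumeration) (use J(1,2) T_pos in auto)
    then obtain n t where t: "t 0 = 0" "\<And>i. i < n \<Longrightarrow> t i < t (Suc i)" "t ` {..n} = insert 0 (insert T J)"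
      by blast
    have mono: "t i \<le> t j" if "i \<le> j" "j \<le> n" for i j
      using that
    proof (induction j rule: dec_induct)
      case (step j)
      then have "t j < t (Suc j)" using t(2)[of j] by auto
      with step show ?case by simp
    qed simp
    have "T \<in> t ` {..n}" unfolding t(3) by simp
    then obtain i where i: "i \<le> n" "t i = T" by auto
    have "t n \<in> t ` {..n}" by simp
    then have "t n \<in> insert 0 (insert T J)" unfolding t(3) .
    then have "t n \<le> T" using J(2) T_pos by auto
    with mono[of i n] i have tn: "t n = T" by simp
    \<comment> \<open>The enumeration starts at 0 and ends at \<open>T > 0\<close>, so it has at
      least two points and fits the shape \<open>l + 1\<close> of the definition.\<close>
    then have "n \<noteq> 0" using t(1) T_pos by (intro notI) simp
    then obtain l where l: "n = l + 1" by (cases n) auto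
    define B where "B i = (if t i \<in> J then A (t i) else UNIV)" for i
    have Cyl: "?E \<inter> space (path_space ?I) = {\<alpha> \<in> space (path_space ?I). \<forall>i\<le>l + 1. \<alpha> (t i) \<in> B i}"
    proof (intro set_eqI)
      fix \<alpha>
      have "(\<forall>i\<le>n. \<alpha> (t i) \<in> B i) \<longleftrightarrow> (\<forall>s\<in>t ` {..n}. s \<in> J \<longrightarrow> \<alpha> s \<in> A s)"
        by (auto simp: B_def)
      also have "\<dots> \<longleftrightarrow> (\<forall>s\<in>J. \<alpha> s \<in> A s)" unfolding t(3) by auto
      finally show "\<alpha> \<in> ?E \<inter> space (path_space ?I) \<longleftrightarrow>
          \<alpha> \<in> {\<alpha> \<in> space (path_space ?I). \<forall>i\<le>l + 1. \<alpha> (t i) \<in> B i}"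
        using J(2) unfolding l by (auto simp: prod_emb_def space_path_space PiE_iff)
    qed
    have B: "\<forall>i\<le>l + 1. B i \<in> sets borel" using J(3) by (simp add: B_def)
    have tt: "\<forall>i\<le>l. t i < t (i + 1)" "t (l + 1) = T" using t(2) l tn by auto
    have "emeasure m (?E \<inter> space (path_space ?I)) = (\<integral>\<^sup>+ x. cylinder_integral p t B 0 (l + 1) x \<partial>\<nu>)"
      unfolding Cyl unfolding space(1)[symmetric] by (rule segment_lawD[OF m t(1) tt(2,1) B])
    moreover have "emeasure m' (?E \<inter> space (path_space ?I)) = (\<integral>\<^sup>+ x. cylinder_integral p t B 0 (l + 1) x \<partial>\<nu>)"
      unfolding Cyl unfolding space(2)[symmetric] by (rule segment_lawD[OF m' t(1) tt(2,1) B])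
    ultimately show "emeasure (distr m ?PiM (\<lambda>w. w)) ?E = emeasure (distr m' ?PiM (\<lambda>w. w)) ?E"
      using E idm by (simp add: emeasure_distr space)
  qed simp_all
  show ?thesis
  proof (rule measure_eqI)
    show "sets m = sets m'" using sets by simp
    fix A assume "A \<in> sets m"
    then obtain A' where A': "A' \<in> sets ?PiM" "A = {w. continuous_on ?I w} \<inter> A'"
      using sets(1) by (auto simp: path_space_def sets_restrict_space)
    then have "A = A' \<inter> space (path_space ?I)"
      using sets.sets_into_space[OF A'(1)] by (auto simp: space_path_space space_PiM PiE_def)
    then show "emeasure m A = emeasure m' A"
      using arg_cong[OF eq, of "\<lambda>M. emeasure M A'"] A'(1) idm by (simp add: emeasure_distr space)
  qed
qed

end

section \<open>Averages along a single path\<close>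

lemma infinitely_often_of_average:
  assumes lim: "(\<lambda>n. (\<Sum>j<n. indicat_real B (a j)) / real n) \<longlonglongrightarrow> c" and "0 < c"
  shows "\<exists>\<^sub>\<infinity>j. a j \<in> B"
proof (rule ccontr)
  assume "\<not> ?thesis"
  then have fin: "finite {j. a j \<in> B}" by (simp add: frequently_cofinite)
  have "(\<lambda>n. real (card {j. a j \<in> B}) / real n) \<longlonglongrightarrow> 0"
    by (rule lim_const_over_n)
  moreover have "(\<Sum>j<n. indicat_real B (a j)) / real n \<le> real (card {j. a j \<in> B}) / real n" for n
  proof -
    have "(\<Sum>j<n. indicat_real B (a j)) = real (card {j \<in> {..<n}. a j \<in> B})"
      by (simp add: indicator_def sum.If_cases Int_def)
    also have "\<dots> \<le> real (card {j. a j \<in> B})"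
      using fin by (intro of_nat_mono card_mono) auto
    finally show ?thesis by (rule divide_right_mono) simp
  qed
  ultimately have "c \<le> 0"
    by (intro LIMSEQ_le[OF lim]) auto
  with \<open>0 < c\<close> show False by simp
qed

text \<open>With \<open>N\<close> the integer part of \<open>t / T\<close>, monotonicity places
  \<open>a t / t\<close> between \<open>a (N T) / ((N+1) T)\<close> and
  \<open>a ((N+1) T) / (N T)\<close>. Both bounds are lattice averages times \<open>N/(N+1)\<close>
  or its inverse, divided by \<open>T\<close>.\<close>

lemma tendsto_average_of_lattice:
  fixes a :: "real \<Rightarrow> real"
  assumes T: "0 < T" and mono: "mono_on {0..} a" and a0: "a 0 = 0"
    and lim: "(\<lambda>n. a (real n * T) / real n) \<longlonglongrightarrow> c"
  shows "((\<lambda>t. (1 / t) * a t) \<longlongrightarrow> (1 / T) * c) at_top"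
proof -
  define N where "N t = nat \<lfloor>t / T\<rfloor>" for t
  have N: "filterlim N sequentially at_top"
    unfolding N_def using T by real_asymp
  have lim_Suc: "(\<lambda>n. a (real (Suc n) * T) / real (Suc n)) \<longlonglongrightarrow> c"
    using lim by (rule LIMSEQ_Suc)
  have r1: "(\<lambda>n. real n / real (Suc n) / T) \<longlonglongrightarrow> 1 / T"
    using T by real_asymp (simp add: inverse_eq_divide)
  have r2: "(\<lambda>n. real (Suc n) / real n / T) \<longlonglongrightarrow> 1 / T"
    using T by real_asymp (simp add: inverse_eq_divide)
  have low: "((\<lambda>t. a (real (N t) * T) / real (N t) * (real (N t) / real (Suc (N t)) / T)) \<longlongrightarrow> c * (1 / T)) at_top"
    using filterlim_compose[OF tendsto_mult[OF lim r1] N] .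
  have up: "((\<lambda>t. a (real (Suc (N t)) * T) / real (Suc (N t)) * (real (Suc (N t)) / real (N t) / T)) \<longlongrightarrow> c * (1 / T)) at_top"
    using filterlim_compose[OF tendsto_mult[OF lim_Suc r2] N] .
  \<comment> \<open>Taking \<open>t\<close> at least \<open>T\<close> keeps \<open>N t\<close>
    positive, so no quotient is a division by zero.\<close>
  have bounds: "a (real (N t) * T) / real (N t) * (real (N t) / real (Suc (N t)) / T) \<le> (1 / t) * a t \<and>
      (1 / t) * a t \<le> a (real (Suc (N t)) * T) / real (Suc (N t)) * (real (Suc (N t)) / real (N t) / T)"
    if t: "T \<le> t" for t
  proof -
    have t0: "0 < t" using T t by simp
    have "1 \<le> t / T" using T t by simp
    then have "1 \<le> \<lfloor>t / T\<rfloor>" by linarith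
    then have Npos: "0 < N t" by (simp add: N_def)
    have "real (N t) = of_int \<lfloor>t / T\<rfloor>"
      using \<open>1 \<le> \<lfloor>t / T\<rfloor>\<close> by (simp add: N_def)
    then have "real (N t) \<le> t / T" "t / T < real (Suc (N t))" by linarith+
    then have Nt: "real (N t) * T \<le> t" "t \<le> real (Suc (N t)) * T"
      using T by (simp_all add: field_simps)
    have N0: "0 \<le> real (N t) * T" using T by simp
    have a_le: "a (real (N t) * T) \<le> a t" "a t \<le> a (real (Suc (N t)) * T)" "0 \<le> a (real (N t) * T)"
      using mono_onD[OF mono, of "real (N t) * T" t] mono_onD[OF mono, of t "real (Suc (N t)) * T"]
        mono_onD[OF mono, of 0 "real (N t) * T"] Nt N0 t0 T a0 by auto
    have "a (real (N t) * T) / (real (Suc (N t)) * T) \<le> a t / t"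
      using a_le Nt t0 by (intro frac_le) auto
    moreover have "a t / t \<le> a (real (Suc (N t)) * T) / (real (N t) * T)"
      using a_le Nt Npos T by (intro frac_le) auto
    ultimately show ?thesis using Npos by simp
  qed
  have "((\<lambda>t. (1 / t) * a t) \<longlongrightarrow> c * (1 / T)) at_top"
  proof (rule tendsto_sandwich[OF _ _ low up])
    show "\<forall>\<^sub>F t in at_top. a (real (N t) * T) / real (N t) * (real (N t) / real (Suc (N t)) / T) \<le> (1 / t) * a t"
      using eventually_ge_at_top[of T] by eventually_elim (use bounds in blast)
    show "\<forall>\<^sub>F t in at_top. (1 / t) * a t \<le> a (real (Suc (N t)) * T) / real (Suc (N t)) * (real (Suc (N t)) / real (N t) / T)"
      using eventually_ge_at_top[of T] by eventually_elim (use bounds in blast)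
  qed
  then show ?thesis by (simp add: mult.commute)
qed

section \<open>The Harris recurrent case\<close>

locale harris_markov = periodic_markov +
  fixes \<mu> :: "real measure"
  assumes harris: "positive_harris borel (trans_kernel p 0 T) P (\<lambda>_ k. \<xi> (real k * T)) \<mu>"
begin

lemma prob_space_\<mu>: "prob_space \<mu>" and sets_\<mu>: "sets \<mu> = sets borel"
  and invariant_\<mu>: "\<mu> \<bind> trans_kernel p 0 T = \<mu>"
  and recurrent_\<mu>: "B \<in> sets borel \<Longrightarrow> 0 < emeasure \<mu> B \<Longrightarrow>
    AE \<omega> in P x. \<exists>\<^sub>\<infinity>k. \<xi> (real k * T) \<omega> \<in> B"
  using harris by (auto simp: positive_harris_def invariant_probability_def)

lemma shift_0: "shift w 0 = w T"
  by (simp add: shift_def)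

lemma nn_integral_path_law:
  "f \<in> borel_measurable (path_space {0..}) \<Longrightarrow> (\<integral>\<^sup>+w. f w \<partial>path_law x) = (\<integral>\<^sup>+\<omega>. f (path 0 \<omega>) \<partial>P x)"
  unfolding path_law_def using path_measurable[of 0] by (intro nn_integral_distr) simp_all

sublocale H: harris_paths "path_space {0..}" borel "C_space T" path_law shift first_segment "\<lambda>w. w 0" \<mu>
proof (rule harris_paths.intro)
  show "path_law \<in> borel \<rightarrow>\<^sub>M prob_algebra (path_space {0..})" by (rule path_law_measurable)
  show "shift \<in> path_space {0..} \<rightarrow>\<^sub>M path_space {0..}" by (rule shift_measurable)
  show "first_segment \<in> path_space {0..} \<rightarrow>\<^sub>M C_space T" by (rule restrict_measurable)
  show "(\<lambda>w. w 0) \<in> borel_measurable (path_space {0..})" by simp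
  show "prob_space \<mu>" by (rule prob_space_\<mu>)
  show "sets \<mu> = sets borel" by (rule sets_\<mu>)
next
  fix x :: real
  have "AE \<omega> in P x. path 0 \<omega> 0 = x"
    using \<xi>_start[of x] by (simp add: path_def)
  then show "AE w in path_law x. w 0 = x"
    unfolding path_law_def using path_measurable[of 0] by (subst AE_distr_iff) simp_all
next
  fix x G H assume G: "G \<in> sets (C_space T)" and H: "H \<in> sets (path_space {0..})"
  \<comment> \<open>The first segment is determined by time \<open>T\<close>, so this event belongs
    to the past at \<open>T\<close> and the Markov property with \<open>k = 1\<close> applies to
    it.\<close>
  define G' where "G' = {\<omega> \<in> space \<A>. segment T \<xi> (Suc 0) \<omega> \<in> G}"
  have "G' = segment T \<xi> (Suc 0) -` G \<inter> space (\<F> (real 1 * T))" by (auto simp: G'_def)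
  also have "\<dots> \<in> sets (\<F> (real 1 * T))"
    by (rule measurable_sets[OF segment_measurable_\<F> G]) simp
  finally have G': "G' \<in> sets (\<F> (real 1 * T))" .
  have [measurable]: "shift \<in> path_space {0..} \<rightarrow>\<^sub>M path_space {0..}" "first_segment \<in> path_space {0..} \<rightarrow>\<^sub>M C_space T"
    by (rule shift_measurable, rule restrict_measurable)
  note [measurable] = G H path_law_subprob
  have first: "first_segment (path 0 \<omega>) = segment T \<xi> (Suc 0) \<omega>" for \<omega>
    using segment_eq_restrict[of 0 \<omega>] by simp
  have "{w \<in> space (path_space {0..}). first_segment w \<in> G \<and> shift w \<in> H} \<in> sets (path_space {0..})"
    by measurable
  then have "emeasure (path_law x) {w \<in> space (path_space {0..}). first_segment w \<in> G \<and> shift w \<in> H}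
      = emeasure (P x) {\<omega> \<in> G'. path (real 1 * T) \<omega> \<in> H}"
    using path_in_path_space[of 0] shift_path[of 0]
    by (subst emeasure_path_law) (auto simp: G'_def first intro!: arg_cong[where f="emeasure (P x)"])
  also have "\<dots> = (\<integral>\<^sup>+\<omega>. emeasure (path_law (\<xi> (real 1 * T) \<omega>)) H * indicator G' \<omega> \<partial>P x)"
    by (rule path_markov[OF G' H])
  also have "\<dots> = (\<integral>\<^sup>+\<omega>. emeasure (path_law (shift (path 0 \<omega>) 0)) H
      * indicator {w \<in> space (path_space {0..}). first_segment w \<in> G} (path 0 \<omega>) \<partial>P x)"
    using path_in_path_space[of 0] T_pos
    by (intro nn_integral_cong) (auto simp: G'_def first shift_path indicator_def path_def[of T])
  also have "\<dots> = (\<integral>\<^sup>+w. emeasure (path_law (shift w 0)) H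
      * indicator {w \<in> space (path_space {0..}). first_segment w \<in> G} w \<partial>path_law x)"
    by (rule nn_integral_path_law[symmetric]) measurable
  finally show "emeasure (path_law x) {w \<in> space (path_space {0..}). first_segment w \<in> G \<and> shift w \<in> H}
      = (\<integral>\<^sup>+w. emeasure (path_law (shift w 0)) H
        * indicator {w \<in> space (path_space {0..}). first_segment w \<in> G} w \<partial>path_law x)" .
next
  show "distr (\<mu> \<bind> path_law) borel (\<lambda>w. shift w 0) = \<mu>"
    unfolding shift_0
    using distr_bind_path_law_T[OF sets_\<mu>] prob_space.not_empty[OF prob_space_\<mu>] invariant_\<mu> by simp
next
  fix B :: "real set" and x :: real
  assume B: "B \<in> sets borel" "0 < emeasure \<mu> B"
  note [measurable] = B(1) shift_measurable
  have funpow[measurable]: "shift ^^ k \<in> path_space {0..} \<rightarrow>\<^sub>M path_space {0..}" for k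
    by (induction k) (auto intro: measurable_comp[OF _ shift_measurable])
  have "AE \<omega> in P x. \<exists>k. (shift ^^ k) (path 0 \<omega>) 0 \<in> B"
    using recurrent_\<mu>[OF B, of x]
  proof eventually_elim
    case (elim \<omega>)
    then obtain k where "\<xi> (real k * T) \<omega> \<in> B" by (auto simp: INFM_nat)
    then have "(shift ^^ k) (path 0 \<omega>) 0 \<in> B"
      unfolding funpow_shift_path by (simp add: path_def)
    then show ?case ..
  qed
  moreover have "{w \<in> space (path_space {0..}). \<exists>k. (shift ^^ k) w 0 \<in> B} \<in> sets (path_space {0..})"
    by measurable
  ultimately show "AE w in path_law x. \<exists>k. (shift ^^ k) w 0 \<in> B"
    unfolding path_law_def using path_measurable[of 0] by (subst AE_distr_iff) simp_all
qed

lemma \<mu>_nonempty: "space \<mu> \<noteq> {}"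
  by (rule prob_space.not_empty[OF prob_space_\<mu>])

lemma segment_measure_eq: "H.segment_measure = distr (\<mu> \<bind> path_law) (C_space T) first_segment"
  by (simp add: H.segment_measure_def H.stationary_law_def)

lemma segment_lln:
  assumes "f \<in> borel_measurable (C_space T)" and "integrable H.segment_measure f"
  shows "AE \<omega> in P x. (\<lambda>n. (\<Sum>j<n. f (segment T \<xi> (Suc j) \<omega>)) / real n)
    \<longlonglongrightarrow> (\<integral>\<alpha>. f \<alpha> \<partial>H.segment_measure)"
proof -
  have "path 0 \<in> P x \<rightarrow>\<^sub>M path_space {0..}" using path_measurable[of 0] by simp
  from AE_distrD[OF this, folded path_law_def, OF H.law_of_large_numbers[OF assms]]
  show ?thesis by (simp add: funpow_shift_path segment_eq_restrict)
qed

text \<open>The segment measure is the law of the first segment when the starting point has law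
  \<mu>. Its endpoint again has law \<mu>, because \<mu> is invariant over one period, so the next
  segment has the same law.\<close>

lemma invariant_segment_measure:
  "invariant_probability (C_space T) (segment_kernel T P \<xi>) H.segment_measure"
proof -
  have "H.segment_measure \<bind> segment_kernel T P \<xi>
      = distr (distr H.segment_measure borel (\<lambda>\<alpha>. \<alpha> T) \<bind> path_law) (C_space T) first_segment"
    using prob_space.not_empty[OF H.prob_space_segment_measure] by (intro bind_segment_kernel) auto
  also have "distr H.segment_measure borel (\<lambda>\<alpha>. \<alpha> T) = \<mu>"
    unfolding segment_measure_eq distr_bind_path_law_segment_T[OF sets_\<mu> \<mu>_nonempty]
      distr_bind_path_law_T[OF sets_\<mu> \<mu>_nonempty] by (rule invariant_\<mu>)
  finally have "H.segment_measure \<bind> segment_kernel T P \<xi> = H.segment_measure"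
    by (simp only: segment_measure_eq[symmetric])
  then show ?thesis
    using H.prob_space_segment_measure H.sets_segment_measure
    unfolding invariant_probability_def by blast
qed

text \<open>An invariant \<open>m\<close> is recovered from its endpoint law \<nu> as the law of the
  first segment started from \<nu>. Taking endpoints on both sides shows \<nu> invariant over one
  period, and \<open>segment_law_unique\<close> then identifies that segment law without comparing
  \<nu> with \<mu>.\<close>

lemma invariant_probability_unique:
  assumes "invariant_probability (C_space T) (segment_kernel T P \<xi>) m"
  shows "m = H.segment_measure"
proof -
  have m: "prob_space m" "sets m = sets (C_space T)" "m \<bind> segment_kernel T P \<xi> = m"
    using assms by (auto simp: invariant_probability_def)
  let ?\<nu> = "distr m borel (\<lambda>\<alpha>. \<alpha> T)"
  have \<nu>: "prob_space ?\<nu>"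
    using m T_component_measurable
    by (intro prob_space.prob_space_distr) (simp_all cong: measurable_cong_sets)
  have m_eq: "m = distr (?\<nu> \<bind> path_law) (C_space T) first_segment"
    using bind_segment_kernel[OF m(2) prob_space.not_empty[OF m(1)]] m(3) by simp
  have "?\<nu> = distr (distr (?\<nu> \<bind> path_law) (C_space T) first_segment) borel (\<lambda>\<alpha>. \<alpha> T)"
    using arg_cong[OF m_eq, of "\<lambda>m. distr m borel (\<lambda>\<alpha>. \<alpha> T)"] .
  also have "\<dots> = distr (?\<nu> \<bind> path_law) borel (\<lambda>w. w T)"
    by (rule distr_bind_path_law_segment_T) simp_all
  finally have "distr (?\<nu> \<bind> path_law) borel (\<lambda>w. shift w 0) = ?\<nu>"
    by (simp add: shift_0)
  then have "distr (?\<nu> \<bind> path_law) (C_space T) first_segment = H.segment_measure"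
    by (intro H.segment_law_unique[OF \<nu>]) simp_all
  with m_eq show ?thesis by (rule trans)
qed

text \<open>Recurrence is read off from frequencies: started from any \<alpha>, the segments visit
  \<open>B\<close> with asymptotic frequency \<open>m(B) > 0\<close>, which excludes finitely many
  visits.\<close>

lemma positive_harris_segments:
  "positive_harris (C_space T) (segment_kernel T P \<xi>) (\<lambda>\<alpha>. P (\<alpha> T)) (segment_chain T \<xi>) H.segment_measure"
  unfolding positive_harris_def
proof (intro conjI ballI impI markov_chain_segments invariant_segment_measure)
  interpret m: prob_space H.segment_measure by (rule H.prob_space_segment_measure)
  fix B \<alpha> assume B: "B \<in> sets (C_space T)" "0 < emeasure H.segment_measure B"
  have "AE \<omega> in P (\<alpha> T). (\<lambda>n. (\<Sum>j<n. indicat_real B (segment T \<xi> (Suc j) \<omega>)) / real n)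
      \<longlonglongrightarrow> measure H.segment_measure B"
    using segment_lln[of "indicat_real B" "\<alpha> T"] B(1) by (simp add: m.emeasure_eq_measure)
  then show "AE \<omega> in P (\<alpha> T). \<exists>\<^sub>\<infinity>k. segment_chain T \<xi> \<alpha> k \<omega> \<in> B"
  proof eventually_elim
    case (elim \<omega>)
    then have "\<exists>\<^sub>\<infinity>j. segment T \<xi> (Suc j) \<omega> \<in> B"
      using B(2) by (intro infinitely_often_of_average) (auto simp: m.emeasure_eq_measure)
    then have "\<exists>\<^sub>\<infinity>j. segment_chain T \<xi> \<alpha> (Suc j) \<omega> \<in> B"
      by (simp add: segment_chain_def)
    \<comment> \<open>Passing from the index \<open>j\<close> to \<open>Suc j\<close> only makes the
      indices of the visits larger, so there are still infinitely many.\<close>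
    then show ?case
      unfolding INFM_nat using less_SucI by blast
  qed
qed

lemma additive_functional_limit:
  assumes A: "increasing_process \<A> P \<xi> A"
    and F: "F \<in> borel_measurable (C_space T)" "integrable H.segment_measure F"
    and AF: "AE \<omega> in P x. \<forall>k\<ge>1. A (real k * T) \<omega> = (\<Sum>j=1..k. F (segment T \<xi> j \<omega>))"
  shows "AE \<omega> in P x. ((\<lambda>t. (1 / t) * A t \<omega>) \<longlongrightarrow> (1 / T) * (\<integral>\<alpha>. F \<alpha> \<partial>H.segment_measure)) at_top"
proof -
  have "AE \<omega> in P x. mono_on {0..} (\<lambda>t. A t \<omega>) \<and> A 0 \<omega> = 0"
    using A unfolding increasing_process_def by (auto elim: eventually_mono)
  then show ?thesis
    using AF segment_lln[OF F, of x]
  proof eventually_elim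
    case (elim \<omega>)
    have "A (real n * T) \<omega> = (\<Sum>j<n. F (segment T \<xi> (Suc j) \<omega>))" if "1 \<le> n" for n
      using elim(2) that by (simp add: sum.atLeast1_atMost_eq)
    then have "\<forall>\<^sub>F n in sequentially. (\<Sum>j<n. F (segment T \<xi> (Suc j) \<omega>)) / real n = A (real n * T) \<omega> / real n"
      by (intro eventually_sequentiallyI[of 1]) simp
    from Lim_transform_eventually[OF elim(3) this] elim(1) show ?case
      by (intro tendsto_average_of_lattice T_pos) auto
  qed
qed

end

theorem theorem2p1:
  fixes T :: real
    and \<A> :: "'w measure"
    and P :: "real \<Rightarrow> 'w measure"
    and \<xi> :: "real \<Rightarrow> 'w \<Rightarrow> real"
    and p :: "real \<Rightarrow> real \<Rightarrow> real \<Rightarrow> real \<Rightarrow> real"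
    and \<mu> :: "real measure"
  assumes "T > 0"
    and "continuous_markov_process \<A> P \<xi> p"
    and "periodic_densities T p"
    and "positive_harris borel (trans_kernel p 0 T) P (\<lambda>_ k. \<xi> (real k * T)) \<mu>"
  shows "\<exists>m.
    segment_law T p \<mu> m \<and> (\<forall>m'. segment_law T p \<mu> m' \<longrightarrow> m' = m) \<and>
    positive_harris (C_space T) (segment_kernel T P \<xi>) (\<lambda>\<alpha>. P (\<alpha> T)) (segment_chain T \<xi>) m \<and>
    (\<forall>m'. invariant_probability (C_space T) (segment_kernel T P \<xi>) m' \<longrightarrow> m' = m) \<and>
    (\<forall>A F.
       increasing_process \<A> P \<xi> A \<longrightarrow>
       F \<in> borel_measurable (C_space T) \<longrightarrow>
       (\<forall>\<alpha>\<in>space (C_space T). 0 \<le> F \<alpha>) \<longrightarrow>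
       integrable m F \<longrightarrow>
       (\<forall>x. AE \<omega> in P x. \<forall>k\<ge>1. A (real k * T) \<omega> = (\<Sum>j=1..k. F (segment T \<xi> j \<omega>))) \<longrightarrow>
       (\<forall>x. AE \<omega> in P x. ((\<lambda>t. (1 / t) * A t \<omega>) \<longlongrightarrow> (1 / T) * (\<integral>\<alpha>. F \<alpha> \<partial>m)) at_top))"
proof -
  interpret harris_markov T \<A> P \<xi> p \<mu>
    by unfold_locales (use assms in auto)
  have law: "segment_law T p \<mu> H.segment_measure"
    unfolding segment_measure_eq by (rule segment_law_bind_path_law[OF prob_space_\<mu> sets_\<mu>])
  show ?thesis
  proof (intro exI[of _ H.segment_measure] conjI allI impI law positive_harris_segments)
    show "m' = H.segment_measure" if "segment_law T p \<mu> m'" for m'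
      using that law by (rule segment_law_eqI)
    show "m' = H.segment_measure" if "invariant_probability (C_space T) (segment_kernel T P \<xi>) m'" for m'
      using that by (rule invariant_probability_unique)
    fix A F x
    assume "increasing_process \<A> P \<xi> A" "F \<in> borel_measurable (C_space T)" "integrable H.segment_measure F"
      and "\<forall>x. AE \<omega> in P x. \<forall>k\<ge>1. A (real k * T) \<omega> = (\<Sum>j=1..k. F (segment T \<xi> j \<omega>))"
    then show "AE \<omega> in P x. ((\<lambda>t. (1 / t) * A t \<omega>) \<longlongrightarrow> (1 / T) * (\<integral>\<alpha>. F \<alpha> \<partial>H.segment_measure)) at_top"
      by (intro additive_functional_limit) blast+
  qed
qed

end
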